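(* Let $n,k,i,d$ be integers with $1\leq k\leq\frac n2$, $0\leq i\leq n-1$ and $0\le d\le n-1$. A surjective linear projection $\pi:\mathbb{R}^{n-1}\to\mathbb{R}^d$ is $i$-preserving for the hypersimplex $\Delta_{n,k}$ if and only if at least one of the following holds: (i) $S_\pi$ is $(k+i)$-neighborly; (ii) $S_\pi$ is $(n-2)$-dimensional and not $(k-i-1)$-almost neighborly; (iii) $\pi$ is an affine isomorphism. In particular, such an $i$-preserving projection exists only if at least one of the following holds: (i) $2k+2i\leq d\leq n-1$ (or $d=n-1\geq k+i$); (ii) $d=n-2$ and $k\geq i+2$; (iii) $d=n-1$.
   Context: The hypersimplex is $\Delta_{n,k}=\operatorname{conv}\{x\in\{0,1\}^n:\sum_j x_j=k\}$. It is identified with its image under the projection $\mathbb{R}^n\to\mathbb{R}^n/(\mathbb{R}\cdot\mathbf 1)\cong\mathbb{R}^{n-1}$ ($\mathbf 1$ the all-ones vector), where it is a full-dimensional polytope. Write $\bar{\mathbf e}_j\in\mathbb{R}^{n-1}$ for the image of the $j$-th standard basis vector of $\mathbb{R}^n$. For a polytope $P$, a face $F$ is strictly preserved under $\pi$ if $\pi(F)$ is a face of $\pi(P)$, $P\cap\pi^{-1}(\pi(F))=F$, and $F\to\pi(F)$ is a bijection. The projection $\pi$ is $i$-preserving for $\Delta_{n,k}$ if every face of dimension at most $i$ of $\Delta_{n,k}$ is strictly preserved. $S_\pi=(\pi(\bar{\mathbf e}_1),\dots,\pi(\bar{\mathbf e}_n))$ is a configuration of $n$ labelled points in $\mathbb{R}^d$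 (points with different labels count as different elements, even if they coincide). A configuration $S$ is $j$-neighborly if every subset of at most $j$ points of $S$ is the vertex set of a face of $\operatorname{conv}(S)$ (in particular, for $j\ge1$ the points of $S$ are pairwise distinct and in convex position). $S$ is $j$-almost neighborly if every subset of at most $j$ points of $S$ lies in a common proper face of $\operatorname{conv}(S)$ (the empty face being a proper face, so that every configuration is $j$-almost neighborly for all $j\leq 0$). The dimension of $S$ is the dimension of its affine hull. *)

theory Defs
  imports "HOL-Analysis.Analysis"
begin

definition hypersimplex :: "nat \<Rightarrow> (real ^ 'n) set" where
  "hypersimplex k =
     convex hull {x. (\<forall>j. x $ j \<in> {0, 1}) \<and> (\<Sum>j\<in>UNIV. x $ j) = real k}"

text \<open>
  A quotient map with kernel spanned by the all-ones vector: a choice of identification of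
  the target space with \<open>\<real>\<^sup>n / (\<real> \<cdot> 1)\<close>; the target then has dimension \<open>n - 1\<close>.
\<close>
definition ones_quotient :: "(real ^ 'n \<Rightarrow> 'a::euclidean_space) \<Rightarrow> bool" where
  "ones_quotient q \<longleftrightarrow> linear q \<and> surj q \<and> {x. q x = 0} = span {\<chi> j. 1}"

definition strictly_preserved ::
    "('a::euclidean_space \<Rightarrow> 'b::euclidean_space) \<Rightarrow> 'a set \<Rightarrow> 'a set \<Rightarrow> bool" where
  "strictly_preserved \<pi> P F \<longleftrightarrow>
     \<pi> ` F face_of \<pi> ` P \<and> P \<inter> \<pi> -` (\<pi> ` F) = F \<and> bij_betw \<pi> F (\<pi> ` F)"

definition preserving ::
    "nat \<Rightarrow> ('a::euclidean_space \<Rightarrow> 'b::euclidean_space) \<Rightarrow> 'a set \<Rightarrow> bool" where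
  "preserving i \<pi> P \<longleftrightarrow>
     (\<forall>F. F face_of P \<and> aff_dim F \<le> int i \<longrightarrow> strictly_preserved \<pi> P F)"

text \<open>
  A configuration of labelled points is a family \<open>S\<close> over a finite type of labels, and its
  subsets are sets of labels. A face's vertex set consists of \<^emph>\<open>all\<close> labels whose point is a
  vertex of it; two labels carrying the same point can thus not be separated, which makes the
  points of a \<open>j\<close>-neighborly configuration pairwise distinct if \<open>j \<ge> 1\<close>.
  The bound \<open>j\<close> is an integer, as negative values occur.
\<close>
definition neighborly :: "int \<Rightarrow> ('n::finite \<Rightarrow> 'b::euclidean_space) \<Rightarrow> bool" where
  "neighborly j S \<longleftrightarrow>
     (\<forall>J. int (card J) \<le> j \<longrightarrow>
        (\<exists>F. F face_of convex hull (range S) \<and> {l. S l extreme_point_of F} = J))"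

definition almost_neighborly :: "int \<Rightarrow> ('n::finite \<Rightarrow> 'b::euclidean_space) \<Rightarrow> bool" where
  "almost_neighborly j S \<longleftrightarrow>
     (\<forall>J. int (card J) \<le> j \<longrightarrow>
        (\<exists>F. F face_of convex hull (range S) \<and> F \<noteq> convex hull (range S) \<and> S ` J \<subseteq> F))"

text \<open>The configuration of the images of the (projected) standard basis vectors.\<close>
definition proj_config ::
    "(real ^ 'n \<Rightarrow> 'a::euclidean_space) \<Rightarrow> ('a \<Rightarrow> 'b::euclidean_space) \<Rightarrow> 'n \<Rightarrow> 'b" where
  "proj_config q \<pi> = (\<lambda>j. \<pi> (q (axis j 1)))"

text \<open>
  The target \<open>\<real>\<^sup>d\<close> of a projection is a \<open>d\<close>-dimensional linear subspace \<open>W\<close> of an arbitrary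
  Euclidean space rather than a type, because every type of class \<open>euclidean_space\<close> has positive
  dimension and \<open>d = 0\<close> has to be included.
\<close>
definition linear_projection_onto ::
    "'b set \<Rightarrow> ('a::euclidean_space \<Rightarrow> 'b::euclidean_space) \<Rightarrow> bool" where
  "linear_projection_onto W \<pi> \<longleftrightarrow> linear \<pi> \<and> range \<pi> = W"

end

theory Submission
  imports Defs
begin

text \<open>
  For a face of a polytope, strict preservation means that no other point of the polytope has the
  same image as a point of the face. The points of \<open>\<Delta>\<^bsub>n,k\<^esub>\<close> on faces of dimension at most \<open>i\<close> are
  those with at most \<open>i + 1\<close> coordinates strictly between 0 and 1, and the kernel of \<open>\<pi>\<close> is the space
  of affine dependences of \<open>S\<^sub>\<pi>\<close>. Comparing signs, \<open>\<pi>\<close> is \<open>i\<close>-preserving iff every nonzero affine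
  dependence has more than \<open>k + i\<close> negative or more than \<open>n - k + i\<close> positive entries. These two open
  conditions exclude each other, and negation maps the second into the first; so if the space of
  dependences has dimension at least 2, its punctured connectedness leaves only the first
  condition, which says that \<open>S\<^sub>\<pi>\<close> is \<open>(k + i)\<close>-neighborly. In dimension 1 the second condition
  says that \<open>S\<^sub>\<pi>\<close> is not \<open>(k - i - 1)\<close>-almost neighborly.
\<close>

subsection \<open>Linear algebra and faces\<close>

text \<open>Rank-nullity: \<open>f\<close> is injective on the orthogonal complement
  \<open>C\<close> of its kernel and already attains its whole range there.\<close>

lemma dim_range_plus_dim_kernel:
  fixes f :: "'a::euclidean_space \<Rightarrow> 'b::euclidean_space"
  assumes "linear f"
  shows "dim (range f) + dim {x. f x = 0} = DIM('a)"
proof -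
  interpret linear f by fact
  let ?K = "{x. f x = 0}"
  have K: "subspace ?K"
    by (simp add: subspace_def zero add scale)
  define C where "C = {y. \<forall>x\<in>?K. orthogonal x y}"
  have C: "subspace C"
    unfolding C_def using subspace_orthogonal_to_vectors by blast
  have "dim C + dim ?K = DIM('a)"
    using dim_subspace_orthogonal_to_vectors[OF K subspace_UNIV] by (simp add: C_def)
  moreover have "f ` C = range f"
  proof
    show "range f \<subseteq> f ` C"
    proof clarify
      fix x
      obtain y z where yz: "y \<in> span ?K" "\<And>w. w \<in> span ?K \<Longrightarrow> orthogonal z w" "x = y + z"
        using orthogonal_subspace_decomp_exists by metis
      moreover have "span ?K = ?K" using K by simp
      ultimately have "f x = f z" "z \<in> C"
        by (auto simp: C_def add orthogonal_commute)
      then show "f x \<in> f ` C" by blast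
    qed
  qed auto
  moreover have "dim (f ` C) = dim C"
  proof (rule dim_image_eq[OF assms])
    have "x = 0" if "x \<in> C" "f x = 0" for x
      using that by (auto simp: C_def orthogonal_def)
    moreover have "span C = C" using C by simp
    ultimately show "inj_on f (span C)"
      using subspace_diff[OF C] by (metis (no_types, lifting) diff eq_iff_diff_eq_0 inj_onI)
  qed
  ultimately show ?thesis by simp
qed

text \<open>For the nontrivial direction, lift a segment in the image through a point of the image
  of \<open>F\<close> to a segment in \<open>P\<close>. Its lifted inner point has the same image as
  a point \<open>w\<close> of \<open>F\<close>, hence equals \<open>w\<close>, and the face property
  of \<open>F\<close> captures the lifted endpoints.\<close>

lemma strictly_preserved_iff:
  assumes "linear \<pi>" "convex P" "F face_of P"
  shows "strictly_preserved \<pi> P F \<longleftrightarrow> (\<forall>x\<in>F. \<forall>y\<in>P. \<pi> x = \<pi> y \<longrightarrow> x = y)"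
proof
  assume "strictly_preserved \<pi> P F"
  then show "\<forall>x\<in>F. \<forall>y\<in>P. \<pi> x = \<pi> y \<longrightarrow> x = y"
    unfolding strictly_preserved_def bij_betw_def inj_on_def by (metis IntI image_eqI vimageI)
next
  assume fib: "\<forall>x\<in>F. \<forall>y\<in>P. \<pi> x = \<pi> y \<longrightarrow> x = y"
  have F: "F \<subseteq> P" "convex F" using assms(3) by (auto simp: face_of_def)
  have "\<pi> ` F face_of \<pi> ` P"
    unfolding face_of_def
  proof (intro conjI ballI impI)
    show "convex (\<pi> ` F)" using F(2) assms(1) convex_linear_image by blast
    fix a b x assume "a \<in> \<pi> ` P" "b \<in> \<pi> ` P" "x \<in> \<pi> ` F" and x: "x \<in> open_segment a b"
    then obtain u v w where uvw: "a = \<pi> u" "b = \<pi> v" "x = \<pi> w" "u \<in> P" "v \<in> P" "w \<in> F" by blast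
    from x obtain t where t: "0 < t" "t < 1" "x = (1 - t) *\<^sub>R a + t *\<^sub>R b" "a \<noteq> b"
      by (auto simp: in_segment)
    have "\<pi> w = \<pi> ((1 - t) *\<^sub>R u + t *\<^sub>R v)"
      using t(3) uvw by (simp add: linear_add[OF assms(1)] linear_scale[OF assms(1)])
    moreover have "(1 - t) *\<^sub>R u + t *\<^sub>R v \<in> P"
      using assms(2) uvw t by (simp add: convex_def)
    ultimately have "w = (1 - t) *\<^sub>R u + t *\<^sub>R v" using fib uvw by blast
    then have "w \<in> open_segment u v" using t uvw by (auto simp: in_segment)
    then have "u \<in> F \<and> v \<in> F" using assms(3) uvw by (meson face_of_def)
    then show "a \<in> \<pi> ` F" "b \<in> \<pi> ` F" using uvw by auto
  qed (use F in auto)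
  moreover have "P \<inter> \<pi> -` \<pi> ` F = F" using F fib by (fastforce)
  moreover have "inj_on \<pi> F" using F fib by (auto simp: inj_on_def)
  ultimately show "strictly_preserved \<pi> P F"
    unfolding strictly_preserved_def by (simp add: bij_betw_imageI)
qed

text \<open>The sum lies on the segment from \<open>p l\<close> to the renormalised remaining sum
  \<open>w\<close>, so the face property yields \<open>p l\<close>. If that segment degenerates
  (\<open>u l = 1\<close> or \<open>p l = w\<close>), the sum is \<open>p l\<close> itself.\<close>

lemma face_of_convex_sum_mem:
  fixes p :: "'n::finite \<Rightarrow> 'a::real_vector"
  assumes "F face_of T" "convex T" "\<And>j. p j \<in> T" "\<And>j. 0 \<le> u j" "(\<Sum>j\<in>UNIV. u j) = 1"
    and "(\<Sum>j\<in>UNIV. u j *\<^sub>R p j) \<in> F" "0 < u l"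
  shows "p l \<in> F"
proof -
  let ?x = "\<Sum>j\<in>UNIV. u j *\<^sub>R p j"
  have s: "(\<Sum>j\<in>UNIV - {l}. u j) = 1 - u l" using assms(5) by (simp add: sum_diff1)
  have x: "?x = u l *\<^sub>R p l + (\<Sum>j\<in>UNIV - {l}. u j *\<^sub>R p j)" by (simp add: sum.remove[of UNIV l])
  show ?thesis
  proof (cases "u l = 1")
    case True
    then have "\<forall>j\<in>UNIV - {l}. u j = 0"
      using s assms(4) by (subst sum_nonneg_eq_0_iff[symmetric]) auto
    then have "?x = p l" using x True by simp
    then show ?thesis using assms(6) by simp
  next
    case False
    have "u l \<le> 1" using s sum_nonneg[of "UNIV - {l}" u] assms(4) by simp
    then have lt: "u l < 1" using False by simp
    define w where "w = (\<Sum>j\<in>UNIV - {l}. (u j / (1 - u l)) *\<^sub>R p j)"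
    have "w \<in> T"
      unfolding w_def
      by (rule convex_sum) (use assms lt s in \<open>auto simp: sum_divide_distrib[symmetric]\<close>)
    have "(1 - u l) *\<^sub>R w = (\<Sum>j\<in>UNIV - {l}. u j *\<^sub>R p j)"
      using lt by (simp add: w_def scaleR_sum_right)
    then have x2: "?x = u l *\<^sub>R p l + (1 - u l) *\<^sub>R w" using x by simp
    show ?thesis
    proof (cases "p l = w")
      case True
      then have "?x = p l" using x2 by (simp add: scaleR_left_distrib[symmetric])
      then show ?thesis using assms(6) by simp
    next
      case False
      have "?x \<in> open_segment w (p l)"
        unfolding in_segment using False x2 lt assms(7)
        by (intro conjI exI[of _ "u l"]) (auto simp: add.commute)
      then show ?thesis using assms \<open>w \<in> T\<close> by (meson face_of_def)
    qed
  qed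
qed

subsection \<open>Affine dependences and neighborliness\<close>

text \<open>Coefficients are indexed by labels, so two labels carrying the same point already give a
  nonzero dependence. The zero vector is included to obtain a linear subspace.\<close>

definition affine_dependences :: "('n::finite \<Rightarrow> 'b::real_vector) \<Rightarrow> (real ^ 'n) set" where
  "affine_dependences S = {v. (\<Sum>j\<in>UNIV. v $ j) = 0 \<and> (\<Sum>j\<in>UNIV. v $ j *\<^sub>R S j) = 0}"

lemma subspace_affine_dependences: "subspace (affine_dependences S)"
  by (auto simp: subspace_def affine_dependences_def sum.distrib scaleR_left_distrib
      sum_distrib_left[symmetric] scaleR_sum_right[symmetric] scaleR_scaleR[symmetric]
      simp del: scaleR_scaleR)

lemma affine_dependences_uminus: "v \<in> affine_dependences S \<Longrightarrow> - v \<in> affine_dependences S"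
  by (simp add: subspace_neg subspace_affine_dependences)

lemma sum_zero_imp_ex_pos:
  fixes v :: "real ^ 'n"
  assumes "(\<Sum>j\<in>UNIV. v $ j) = 0" "v \<noteq> 0"
  obtains l where "0 < v $ l"
proof -
  have False if "\<And>l. v $ l \<le> 0"
  proof -
    have "(\<Sum>j\<in>UNIV. - v $ j) = 0" using assms(1) by (simp add: sum_negf)
    then have "\<forall>j\<in>UNIV. - v $ j = 0"
      using that by (subst sum_nonneg_eq_0_iff[symmetric]) auto
    then show False using assms(2) by (simp add: vec_eq_iff)
  qed
  then show thesis using that not_le by blast
qed

text \<open>The point of \<open>F\<close> obtained by normalising the negative part of \<open>v\<close> is also a convex
  combination of the points carrying the positive part.\<close>
lemma face_contains_positive_part:
  fixes S :: "'n::finite \<Rightarrow> 'b::euclidean_space"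
  assumes v: "v \<in> affine_dependences S" and F: "F face_of convex hull (range S)"
    and neg: "\<And>j. v $ j < 0 \<Longrightarrow> S j \<in> F" and l: "0 < v $ l"
  shows "S l \<in> F"
proof -
  \<comment> \<open>\<open>s\<close> is the common total of the positive and the negative part of
    \<open>v\<close>; they agree because the entries sum to 0.\<close>
  define s where "s = (\<Sum>j\<in>UNIV. max 0 (v $ j))"
  have eq: "max 0 (v $ j) = max 0 (- v $ j) + v $ j" for j by simp
  have s2: "s = (\<Sum>j\<in>UNIV. max 0 (- v $ j))"
    using v unfolding s_def by (subst eq) (simp add: sum.distrib affine_dependences_def)
  have "max 0 (v $ l) \<le> s" unfolding s_def by (rule member_le_sum) auto
  then have s: "0 < s" using l by simp
  define x where "x = (\<Sum>j\<in>UNIV. (max 0 (v $ j) / s) *\<^sub>R S j)"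
  have "(\<Sum>j\<in>UNIV. max 0 (v $ j) *\<^sub>R S j) = (\<Sum>j\<in>UNIV. max 0 (- v $ j) *\<^sub>R S j)"
    using v by (subst eq) (simp add: sum.distrib scaleR_left_distrib affine_dependences_def)
  then have "(1 / s) *\<^sub>R (\<Sum>j\<in>UNIV. max 0 (v $ j) *\<^sub>R S j) = (1 / s) *\<^sub>R (\<Sum>j\<in>UNIV. max 0 (- v $ j) *\<^sub>R S j)"
    by simp
  then have x2: "x = (\<Sum>j\<in>UNIV. (max 0 (- v $ j) / s) *\<^sub>R S j)"
    by (simp add: x_def scaleR_sum_right)
  also have "\<dots> = (\<Sum>j\<in>{j. v $ j < 0}. (max 0 (- v $ j) / s) *\<^sub>R S j)"
    by (rule sum.mono_neutral_right) auto
  also have "\<dots> \<in> F"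
  proof (rule convex_sum)
    show "convex F" using F by (simp add: face_of_def)
    have "(\<Sum>j\<in>{j. v $ j < 0}. max 0 (- v $ j)) = s"
      unfolding s2 by (rule sum.mono_neutral_left) auto
    then show "(\<Sum>j\<in>{j. v $ j < 0}. max 0 (- v $ j) / s) = 1"
      using s by (simp only: sum_divide_distrib[symmetric]) simp
  qed (use neg s in \<open>auto simp: divide_nonpos_pos\<close>)
  finally have "x \<in> F" .
  show ?thesis
  proof (rule face_of_convex_sum_mem[OF F])
    show "(\<Sum>j\<in>UNIV. (max 0 (v $ j) / s) *\<^sub>R S j) \<in> F"
      using \<open>x \<in> F\<close> by (simp only: x_def)
    have "(\<Sum>j\<in>UNIV. max 0 (v $ j) / s) = s / s"
      by (simp only: s_def sum_divide_distrib)
    then show "(\<Sum>j\<in>UNIV. max 0 (v $ j) / s) = 1" using s by simp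
  qed (use s l in \<open>auto simp: hull_inc\<close>)
qed

section \<open>Coordinates for the hulls of a configuration\<close>

lemma linear_combination: "linear (\<lambda>v :: real ^ 'n. \<Sum>j\<in>UNIV. v $ j *\<^sub>R S j)"
  by (auto intro!: linearI simp: scaleR_left_distrib sum.distrib scaleR_sum_right)

lemma combination_axis: "(\<Sum>j\<in>UNIV. axis l 1 $ j *\<^sub>R S j) = S l"
  for S :: "'n::finite \<Rightarrow> 'b::real_vector"
  by (simp add: axis_def if_distrib[of "\<lambda>c. c *\<^sub>R _"] cong: if_cong)

text \<open>The configuration is a linear image of the standard basis, and hulls commute with linear
  maps; points of a hull thus receive coefficient vectors indexed by labels, even if
  \<open>S\<close> is not injective.\<close>

lemma image_eq_combination_image:
  "S ` J = (\<lambda>v. \<Sum>j\<in>UNIV. v $ j *\<^sub>R S j) ` (\<lambda>l. axis l 1 :: real ^ 'n) ` J"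
  for S :: "'n::finite \<Rightarrow> 'b::real_vector"
  by (simp add: image_image combination_axis)

lemma sum_axis: "(\<Sum>j\<in>UNIV. axis l (1::real) $ j) = 1"
  by (simp add: axis_def)

lemma affine_hull_imageE:
  fixes S :: "'n::finite \<Rightarrow> 'b::euclidean_space"
  assumes "x \<in> affine hull (S ` J)"
  obtains u :: "real ^ 'n" where "(\<Sum>j\<in>UNIV. u $ j) = 1" "\<And>j. j \<notin> J \<Longrightarrow> u $ j = 0"
    "x = (\<Sum>j\<in>UNIV. u $ j *\<^sub>R S j)"
proof -
  let ?T = "{u :: real ^ 'n. (\<Sum>j\<in>UNIV. u $ j) = 1 \<and> (\<forall>j. j \<notin> J \<longrightarrow> u $ j = 0)}"
  have "affine hull ((\<lambda>l. axis l 1 :: real ^ 'n) ` J) \<subseteq> ?T"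
  proof (rule hull_minimal)
    show "affine ?T"
      by (auto simp: affine_def sum.distrib sum_distrib_left[symmetric])
  qed (auto simp: sum_axis axis_def)
  then show thesis
    using assms that
    unfolding image_eq_combination_image[of S J] affine_hull_linear_image[OF linear_conv_bounded_linear[THEN iffD1, OF linear_combination], symmetric] by blast
qed

lemma convex_hull_imageE:
  fixes S :: "'n::finite \<Rightarrow> 'b::euclidean_space"
  assumes "x \<in> convex hull (S ` J)"
  obtains u :: "real ^ 'n" where "(\<Sum>j\<in>UNIV. u $ j) = 1" "\<And>j. 0 \<le> u $ j"
    "\<And>j. j \<notin> J \<Longrightarrow> u $ j = 0" "x = (\<Sum>j\<in>UNIV. u $ j *\<^sub>R S j)"
proof -
  let ?T = "{u :: real ^ 'n. (\<Sum>j\<in>UNIV. u $ j) = 1 \<and> (\<forall>j. 0 \<le> u $ j) \<and> (\<forall>j. j \<notin> J \<longrightarrow> u $ j = 0)}"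
  have "convex hull ((\<lambda>l. axis l 1 :: real ^ 'n) ` J) \<subseteq> ?T"
  proof (rule hull_minimal)
    show "convex ?T"
      by (auto simp: convex_def sum.distrib sum_distrib_left[symmetric])
  qed (auto simp: sum_axis axis_def)
  then show thesis
    using assms that
    unfolding image_eq_combination_image[of S J] convex_hull_linear_image[OF linear_combination, symmetric] by blast
qed

lemma affine_dependences_diff:
  assumes "(\<Sum>j\<in>UNIV. u $ j) = (\<Sum>j\<in>UNIV. v $ j)"
    and "(\<Sum>j\<in>UNIV. u $ j *\<^sub>R S j) = (\<Sum>j\<in>UNIV. v $ j *\<^sub>R S j)"
  shows "u - v \<in> affine_dependences S"
  using assms by (simp add: affine_dependences_def sum_subtractf scaleR_left_diff_distrib)

text \<open>If the negative support of \<open>v\<close> were the vertex set of a face, that face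
  would also contain a point of the positive support, which is a vertex and so would be listed too.
  Conversely, a failure of the hull of few points to be a face produces a dependence that is
  negative only on these points.\<close>

lemma neighborly_iff:
  fixes S :: "'n::finite \<Rightarrow> 'b::euclidean_space"
  assumes "1 \<le> m"
  shows "neighborly (int m) S \<longleftrightarrow>
    (\<forall>v\<in>affine_dependences S. v \<noteq> 0 \<longrightarrow> m < card {j. v $ j < 0})"
proof (intro iffI ballI impI)
  fix v assume nb: "neighborly (int m) S" and v: "v \<in> affine_dependences S" "v \<noteq> 0"
  show "m < card {j. v $ j < 0}"
  proof (rule ccontr)
    assume "\<not> m < card {j. v $ j < 0}"
    then obtain F where F: "F face_of convex hull (range S)"
        "{l. S l extreme_point_of F} = {j. v $ j < 0}"
      using nb unfolding neighborly_def by (metis not_less of_nat_le_iff)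
    then have neg: "S j \<in> F" if "v $ j < 0" for j
      using that unfolding extreme_point_of_def by blast
    obtain l where l: "0 < v $ l"
      using sum_zero_imp_ex_pos v unfolding affine_dependences_def by blast
    \<comment> \<open>Neighborliness for a singleton makes \<open>S l\<close> a vertex of the whole
      polytope, hence of every face containing it.\<close>
    have "int (card {l}) \<le> int m" using assms by simp
    then obtain G where G: "G face_of convex hull (range S)" "{k. S k extreme_point_of G} = {l}"
      using nb unfolding neighborly_def by blast
    then have "S l extreme_point_of convex hull (range S)"
      using extreme_point_of_face by blast
    then have "S l extreme_point_of F"
      using extreme_point_of_face[OF F(1)] face_contains_positive_part[OF v(1) F(1) neg l] by blast
    then have "v $ l < 0" using F(2) by blast
    then show False using l by simp
  qed
next
  assume gt: "\<forall>v\<in>affine_dependences S. v \<noteq> 0 \<longrightarrow> m < card {j. v $ j < 0}"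
  \<comment> \<open>Two coinciding points would give a dependence with a single negative entry,
    although there must be more than \<open>m \<ge> 1\<close>.\<close>
  have inj: "inj S"
  proof (rule injI, rule ccontr)
    fix k l assume kl: "S k = S l" "k \<noteq> l"
    let ?v = "axis k 1 - axis l 1 :: real ^ 'n"
    have "?v \<in> affine_dependences S"
      by (rule affine_dependences_diff) (simp_all add: sum_axis combination_axis kl)
    moreover have "?v \<noteq> 0" using kl by (simp add: axis_eq_axis)
    moreover have "{j. ?v $ j < 0} = {l}" using kl(2) by (auto simp: axis_def)
    ultimately show False using gt assms by fastforce
  qed
  have face: "convex hull (S ` J) face_of convex hull (range S)" if "card J \<le> m" for J
  proof (rule face_of_convex_hulls)
    \<comment> \<open>A common point has affine coefficients \<open>a\<close> supported on
      \<open>J\<close> and nonnegative coefficients \<open>b\<close> supported off \<open>J\<close>.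
      Their difference \<open>b - a\<close> is a nonzero dependence that can be negative only on
      \<open>J\<close>.\<close>
    show "affine hull (S ` J) \<inter> convex hull (range S - S ` J) = {}"
    proof (rule ccontr)
      assume "\<not> ?thesis"
      then obtain x where x: "x \<in> affine hull (S ` J)" "x \<in> convex hull (range S - S ` J)" by blast
      have "range S - S ` J \<subseteq> S ` (- J)" by blast
      with x(2) have "x \<in> convex hull (S ` (- J))" using hull_mono by blast
      then obtain b :: "real ^ 'n" where b: "(\<Sum>j\<in>UNIV. b $ j) = 1" "\<And>j. 0 \<le> b $ j"
          "\<And>j. j \<notin> - J \<Longrightarrow> b $ j = 0" "x = (\<Sum>j\<in>UNIV. b $ j *\<^sub>R S j)"
        by (rule convex_hull_imageE) blast
      from x(1) obtain a :: "real ^ 'n" where a: "(\<Sum>j\<in>UNIV. a $ j) = 1"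
          "\<And>j. j \<notin> J \<Longrightarrow> a $ j = 0" "x = (\<Sum>j\<in>UNIV. a $ j *\<^sub>R S j)"
        by (rule affine_hull_imageE) blast
      have "b - a \<in> affine_dependences S"
        using a b by (intro affine_dependences_diff) auto
      moreover have "b - a \<noteq> 0"
      proof
        assume "b - a = 0"
        then have "b $ j = 0" for j using a(2)[of j] b(3)[of j] by (cases "j \<in> J") auto
        then show False using b(1) by simp
      qed
      moreover have "card {j. (b - a) $ j < 0} \<le> card J"
      proof (rule card_mono)
        show "{j. (b - a) $ j < 0} \<subseteq> J" using a(2) b(2) by (force simp: not_le[symmetric])
      qed simp
      ultimately show False using gt that by fastforce
    qed
  qed auto
  show "neighborly (int m) S"
    unfolding neighborly_def
  proof (intro allI impI exI conjI)
    fix J :: "'n set" assume "int (card J) \<le> int m"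
    then show F: "convex hull (S ` J) face_of convex hull (range S)" using face by simp
    have "S l extreme_point_of convex hull (range S)" for l
      using face[of "{l}"] assms by (simp add: face_of_singleton)
    then have "S l extreme_point_of convex hull (S ` J)" if "l \<in> J" for l
      using extreme_point_of_face[OF F] that by (simp add: hull_inc)
    moreover have "l \<in> J" if "S l extreme_point_of convex hull (S ` J)" for l
      using extreme_point_of_convex_hull[OF that] inj by (auto dest: injD)
    ultimately show "{l. S l extreme_point_of convex hull (S ` J)} = J" by blast
  qed
qed

text \<open>A face containing the points with nonpositive coefficient also contains those with
  positive coefficient, hence all points, and is not proper.\<close>

lemma not_almost_neighborly_if_dependence:
  assumes v: "v \<in> affine_dependences S" "v \<noteq> 0" and card: "int (card {l. v $ l \<le> 0}) \<le> m"
  shows "\<not> almost_neighborly m S"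
proof
  assume "almost_neighborly m S"
  then obtain F where F: "F face_of convex hull (range S)" "F \<noteq> convex hull (range S)"
      "S ` {l. v $ l \<le> 0} \<subseteq> F"
    using card unfolding almost_neighborly_def by blast
  have "S l \<in> F" for l
  proof (cases "0 < v $ l")
    case True
    show ?thesis
      by (rule face_contains_positive_part[OF v(1) F(1) _ True]) (use F(3) in auto)
  qed (use F(3) in auto)
  then have "convex hull (range S) \<subseteq> F"
    using F(1) by (intro hull_minimal) (auto simp: face_of_def)
  then show False using F(1,2) by (auto simp: face_of_def)
qed

text \<open>If the points of \<open>J\<close> lie in no common proper face, then their barycentre is a relative
  interior point, hence a convex combination of all points with positive coefficients.\<close>
lemma dependence_if_not_almost_neighborly:
  fixes S :: "'n::finite \<Rightarrow> 'b::euclidean_space"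
  assumes "\<not> almost_neighborly m S" "m < int CARD('n)"
  obtains v where "v \<in> affine_dependences S" "v \<noteq> 0" "int (card {l. v $ l \<le> 0}) \<le> m" "1 \<le> m"
proof -
  let ?P = "convex hull (range S)"
  obtain J where J: "int (card J) \<le> m"
      "\<And>F. F face_of ?P \<Longrightarrow> F \<noteq> ?P \<Longrightarrow> \<not> S ` J \<subseteq> F"
    using assms(1) unfolding almost_neighborly_def by blast
  have "?P \<noteq> {}" by (simp add: convex_hull_eq_empty)
  \<comment> \<open>The empty face is proper, so the empty set of labels cannot be a witness; this
    is the source of \<open>1 \<le> m\<close>.\<close>
  then have "J \<noteq> {}" using J(2)[OF empty_face_of] by (metis image_empty order_refl)
  then have cJ: "0 < card J" by (simp add: card_gt_0_iff)
  define \<mu> :: "real ^ 'n" where "\<mu> = (\<chi> j. if j \<in> J then 1 / card J else 0)"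
  have \<mu>: "(\<Sum>j\<in>UNIV. \<mu> $ j) = 1" "\<And>j. 0 \<le> \<mu> $ j"
    using \<open>J \<noteq> {}\<close> by (simp_all add: \<mu>_def sum.If_cases)
  define y where "y = (\<Sum>j\<in>UNIV. \<mu> $ j *\<^sub>R S j)"
  have yP: "y \<in> ?P"
    unfolding y_def by (rule convex_sum) (use \<mu> in \<open>auto simp: hull_inc\<close>)
  have y: "y \<in> rel_interior ?P"
  proof (rule ccontr)
    \<comment> \<open>A supporting hyperplane at a relative boundary point cuts out a proper face
      through \<open>y\<close>. As \<open>y\<close> is a positive combination of the points of
      \<open>J\<close>, this face would contain all of them.\<close>
    assume y: "y \<notin> rel_interior ?P"
    then obtain a where a: "\<And>z. z \<in> ?P \<Longrightarrow> a \<bullet> y \<le> a \<bullet> z"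
        "\<And>z. z \<in> rel_interior ?P \<Longrightarrow> a \<bullet> y < a \<bullet> z"
      using supporting_hyperplane_rel_boundary[OF convex_convex_hull yP y] by metis
    let ?F = "?P \<inter> {z. a \<bullet> z = a \<bullet> y}"
    have F: "?F face_of ?P"
      using a(1) by (intro face_of_Int_supporting_hyperplane_ge) auto
    have "rel_interior ?P \<noteq> {}" by (simp add: rel_interior_eq_empty)
    then obtain z where z: "z \<in> rel_interior ?P" by blast
    then have "z \<in> ?P" using rel_interior_subset by blast
    moreover have "z \<notin> ?F" using a(2)[OF z] by simp
    ultimately have "?F \<noteq> ?P" by blast
    moreover have "S ` J \<subseteq> ?F"
    proof clarify
      fix l assume "l \<in> J"
      show "S l \<in> ?F"
      proof (rule face_of_convex_sum_mem[OF F])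
        show "(\<Sum>j\<in>UNIV. \<mu> $ j *\<^sub>R S j) \<in> ?F" using yP by (simp add: y_def[symmetric])
        show "0 < \<mu> $ l" using \<open>l \<in> J\<close> cJ by (simp add: \<mu>_def)
      qed (use \<mu> in \<open>auto simp: hull_inc\<close>)
    qed
    ultimately show False using J(2)[OF F] by blast
  qed
  let ?n = "real CARD('n)"
  define c where "c = (\<Sum>j\<in>UNIV. (1 / ?n) *\<^sub>R S j)"
  have "c \<in> ?P"
    unfolding c_def by (rule convex_sum) (auto simp: hull_inc)
  then have "c \<in> affine hull ?P" by (rule hull_inc)
  \<comment> \<open>The segment from the barycentre \<open>c\<close> of all points can be prolonged
    a little beyond \<open>y\<close> inside the polytope. Solving for \<open>y\<close> gives it
    positive coefficients at all labels.\<close>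
  then obtain e where e: "1 < e" "(1 - e) *\<^sub>R c + e *\<^sub>R y \<in> ?P"
    using convex_rel_interior_if2[OF convex_convex_hull y] by blast
  from e(2) obtain b :: "real ^ 'n" where b: "(\<Sum>j\<in>UNIV. b $ j) = 1" "\<And>j. 0 \<le> b $ j"
      "(1 - e) *\<^sub>R c + e *\<^sub>R y = (\<Sum>j\<in>UNIV. b $ j *\<^sub>R S j)"
    by (rule convex_hull_imageE) blast
  \<comment> \<open>This is \<open>e\<close> times the difference of the two coefficient vectors of
    \<open>y\<close>: the everywhere positive one minus \<open>\<mu>\<close>, which is supported on
    \<open>J\<close>.\<close>
  define v :: "real ^ 'n" where "v = (\<chi> j. b $ j + (e - 1) / ?n) - e *\<^sub>R \<mu>"
  have "v \<in> affine_dependences S"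
    unfolding v_def
  proof (rule affine_dependences_diff)
    have "(\<Sum>j\<in>UNIV. b $ j + (e - 1) / ?n) = e"
      by (simp add: sum.distrib b(1))
    then show "(\<Sum>j\<in>UNIV. (\<chi> j. b $ j + (e - 1) / ?n) $ j) = (\<Sum>j\<in>UNIV. (e *\<^sub>R \<mu>) $ j)"
      by (simp add: sum_distrib_left[symmetric] \<mu>(1))
    have "(\<Sum>j\<in>UNIV. (b $ j + (e - 1) / ?n) *\<^sub>R S j) = (\<Sum>j\<in>UNIV. b $ j *\<^sub>R S j) + (e - 1) *\<^sub>R c"
      by (simp add: scaleR_left_distrib sum.distrib c_def scaleR_sum_right)
    also have "\<dots> = e *\<^sub>R y" unfolding b(3)[symmetric] by (simp add: algebra_simps)
    finally show "(\<Sum>j\<in>UNIV. (\<chi> j. b $ j + (e - 1) / ?n) $ j *\<^sub>R S j) = (\<Sum>j\<in>UNIV. (e *\<^sub>R \<mu>) $ j *\<^sub>R S j)"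
      by (simp add: y_def scaleR_sum_right)
  qed
  moreover have pos: "0 < v $ l" if "l \<notin> J" for l
    using that b(2)[of l] e(1) by (simp add: v_def \<mu>_def add_nonneg_pos)
  have "{l. v $ l \<le> 0} \<subseteq> J" using pos by (force simp: not_le[symmetric])
  then have "card {l. v $ l \<le> 0} \<le> card J" by (intro card_mono) auto
  moreover have "v \<noteq> 0"
  proof -
    have "J \<noteq> UNIV" using J(1) assms(2) by auto
    then obtain l where "l \<notin> J" by blast
    from pos[OF this] show ?thesis by auto
  qed
  ultimately show thesis using that J(1) cJ by simp
qed

subsection \<open>Faces of the hypersimplex\<close>

lemma convex_cube_slice:
  "convex {x :: real ^ 'n. (\<forall>j. 0 \<le> x $ j \<and> x $ j \<le> 1) \<and> (\<Sum>j\<in>UNIV. x $ j) = real k}"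
  unfolding convex_def
proof (clarsimp simp: sum.distrib sum_distrib_left[symmetric] distrib_right[symmetric])
  fix x y :: "real ^ 'n" and u v :: real and j
  assume "\<forall>j. 0 \<le> x $ j \<and> x $ j \<le> 1" "\<forall>j. 0 \<le> y $ j \<and> y $ j \<le> 1" "0 \<le> u" "0 \<le> v" "u + v = 1"
  then show "u * x $ j + v * y $ j \<le> 1"
    by (intro convex_bound_le) auto
qed

lemma compact_cube_slice:
  "compact {x :: real ^ 'n. (\<forall>j. 0 \<le> x $ j \<and> x $ j \<le> 1) \<and> (\<Sum>j\<in>UNIV. x $ j) = real k}"
proof -
  have "{x :: real ^ 'n. (\<forall>j. 0 \<le> x $ j \<and> x $ j \<le> 1) \<and> (\<Sum>j\<in>UNIV. x $ j) = real k}
      = cbox 0 (\<chi> j. 1) \<inter> {x. (\<Sum>j\<in>UNIV. x $ j) = real k}"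
    by (auto simp: mem_box_cart)
  moreover have "closed {x :: real ^ 'n. (\<Sum>j\<in>UNIV. x $ j) = real k}"
    by (intro closed_Collect_eq continuous_intros)
  ultimately show ?thesis by (simp add: compact_Int_closed)
qed

lemma sum_eq_card_ones_plus_fractional:
  fixes x :: "real ^ 'n"
  assumes "\<And>j. 0 \<le> x $ j \<and> x $ j \<le> 1"
  shows "(\<Sum>j\<in>UNIV. x $ j) = real (card {j. x $ j = 1}) + (\<Sum>j\<in>{j. 0 < x $ j \<and> x $ j < 1}. x $ j)"
proof -
  have "(\<Sum>j\<in>UNIV. x $ j) = (\<Sum>j\<in>{j. x $ j = 1} \<union> {j. 0 < x $ j \<and> x $ j < 1}. x $ j)"
    using assms by (intro sum.mono_neutral_right) (auto simp: less_le)
  also have "\<dots> = (\<Sum>j\<in>{j. x $ j = 1}. x $ j) + (\<Sum>j\<in>{j. 0 < x $ j \<and> x $ j < 1}. x $ j)"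
    by (intro sum.union_disjoint) auto
  also have "(\<Sum>j\<in>{j. x $ j = 1}. x $ j) = real (card {j. x $ j = 1})" by simp
  finally show ?thesis .
qed

text \<open>A single fractional coordinate would put the integer \<open>k\<close> strictly between
  two consecutive integers.\<close>

lemma exists_two_fractional:
  fixes x :: "real ^ 'n"
  assumes x: "\<And>j. 0 \<le> x $ j \<and> x $ j \<le> 1" "(\<Sum>j\<in>UNIV. x $ j) = real k"
    and c: "0 < x $ c" "x $ c < 1"
  obtains l where "l \<noteq> c" "0 < x $ l" "x $ l < 1"
proof -
  have "\<exists>l. l \<noteq> c \<and> 0 < x $ l \<and> x $ l < 1"
  proof (rule ccontr)
    assume "\<not> ?thesis"
    then have "{j. 0 < x $ j \<and> x $ j < 1} = {c}" using c by auto
    then have "real k = real (card {j. x $ j = 1}) + x $ c"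
      using sum_eq_card_ones_plus_fractional[OF x(1)] x(2) by simp
    then have "real (card {j. x $ j = 1}) < real k" "real k < real (card {j. x $ j = 1} + 1)" using c by auto
    then show False by (simp only: of_nat_less_iff)
  qed
  then show thesis using that by blast
qed

lemma small_perturbation_mem_cube_slice:
  fixes x v :: "real ^ 'n"
  assumes x: "\<And>j. 0 \<le> x $ j \<and> x $ j \<le> 1" "(\<Sum>j\<in>UNIV. x $ j) = real k"
    and v: "(\<Sum>j\<in>UNIV. v $ j) = 0" "\<And>j. v $ j < 0 \<Longrightarrow> 0 < x $ j" "\<And>j. 0 < v $ j \<Longrightarrow> x $ j < 1"
  obtains e where "0 < e"
    "x + e *\<^sub>R v \<in> {y. (\<forall>j. 0 \<le> y $ j \<and> y $ j \<le> 1) \<and> (\<Sum>j\<in>UNIV. y $ j) = real k}"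
proof -
  \<comment> \<open>\<open>r j\<close> is the step length at which coordinate \<open>j\<close>
    reaches the boundary of the unit interval; where \<open>v\<close> vanishes, 1 is a harmless
    positive default.\<close>
  define r where "r j = (if v $ j < 0 then x $ j / - v $ j else if 0 < v $ j then (1 - x $ j) / v $ j else 1)" for j
  define e where "e = Min (range r)"
  have "0 < r j" for j
    using v(2,3)[of j] by (auto simp: r_def divide_pos_neg)
  then have e: "0 < e" by (simp add: e_def)
  have er: "e \<le> r j" for j by (simp add: e_def)
  have "0 \<le> x $ j + e * v $ j \<and> x $ j + e * v $ j \<le> 1" for j
  proof -
    consider "v $ j < 0" | "v $ j = 0" | "0 < v $ j" by linarith
    then show ?thesis
    proof cases
      case 1
      then have "e \<le> x $ j / - v $ j" using er[of j] by (simp add: r_def)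
      then have "e * - v $ j \<le> x $ j" using 1 by (subst (asm) pos_le_divide_eq) auto
      then show ?thesis using x(1)[of j] 1 e mult_pos_neg[of e "v $ j"] by (auto)
    next
      case 3
      then have "e \<le> (1 - x $ j) / v $ j" using er[of j] by (simp add: r_def)
      then have "e * v $ j \<le> 1 - x $ j" using 3 by (subst (asm) pos_le_divide_eq) auto
      then show ?thesis using x(1)[of j] 3 e by auto
    qed (use x in simp)
  qed
  moreover have "(\<Sum>j\<in>UNIV. (x + e *\<^sub>R v) $ j) = real k"
    using x(2) v(1) by (simp add: sum.distrib sum_distrib_left[symmetric])
  ultimately show thesis using that e by simp
qed

text \<open>Used when \<open>v\<close> and \<open>- v\<close> are both feasible directions at
  \<open>x\<close>: then \<open>x\<close> is not extreme, and any face through \<open>x\<close>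
  contains both endpoints. The parameter \<open>e / (e + e')\<close> balances the two
  displacements.\<close>

lemma mem_open_segment_opposite:
  fixes x v :: "'a::real_vector"
  assumes "v \<noteq> 0" "0 < e" "0 < e'"
  shows "x \<in> open_segment (x + e *\<^sub>R v) (x + e' *\<^sub>R (- v))"
  unfolding in_segment
proof (intro conjI exI)
  have "(e + e') *\<^sub>R v \<noteq> 0" using assms by simp
  moreover have "(x + e *\<^sub>R v) - (x + e' *\<^sub>R - v) = (e + e') *\<^sub>R v"
    by (simp add: scaleR_left_distrib)
  ultimately show "x + e *\<^sub>R v \<noteq> x + e' *\<^sub>R - v" by (metis eq_iff_diff_eq_0)
  have "(1 - e / (e + e')) *\<^sub>R (x + e *\<^sub>R v) + (e / (e + e')) *\<^sub>R (x + e' *\<^sub>R - v)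
     = x + ((1 - e / (e + e')) * e - (e / (e + e')) * e') *\<^sub>R v"
    by (simp add: algebra_simps)
  also have "(1 - e / (e + e')) * e - (e / (e + e')) * e' = 0"
    using assms by (simp add: field_simps)
  finally show "x = (1 - e / (e + e')) *\<^sub>R (x + e *\<^sub>R v) + (e / (e + e')) *\<^sub>R (x + e' *\<^sub>R - v)"
    by simp
qed (use assms in auto)

text \<open>A point of the slice with one fractional coordinate has a second one, and shifting mass
  between the two in both directions shows that it is not extreme. The extreme points are therefore
  0/1-vectors, and Krein-Milman applies.\<close>

lemma hypersimplex_eq:
  "hypersimplex k = {x :: real ^ 'n. (\<forall>j. 0 \<le> x $ j \<and> x $ j \<le> 1) \<and> (\<Sum>j\<in>UNIV. x $ j) = real k}"
    (is "_ = ?D")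
proof
  show "hypersimplex k \<subseteq> ?D"
    unfolding hypersimplex_def
  proof (rule hull_minimal)
    show "{x :: real ^ 'n. (\<forall>j. x $ j \<in> {0, 1}) \<and> (\<Sum>j\<in>UNIV. x $ j) = real k} \<subseteq> ?D"
      by (auto, (metis insert_iff singleton_iff order_refl zero_le_one)+)
  qed (rule convex_cube_slice)
  have "x $ c \<in> {0, 1}" if "x extreme_point_of ?D" for x :: "real ^ 'n" and c
  proof (rule ccontr)
    assume nc: "x $ c \<notin> {0, 1}"
    have x: "\<And>j. 0 \<le> x $ j \<and> x $ j \<le> 1" "(\<Sum>j\<in>UNIV. x $ j) = real k"
      using that by (auto simp: extreme_point_of_def)
    have c: "0 < x $ c" "x $ c < 1" using nc x(1)[of c] by auto
    obtain l where l: "l \<noteq> c" "0 < x $ l" "x $ l < 1"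
      using exists_two_fractional[OF x c] by blast
    define v :: "real ^ 'n" where "v = axis l 1 - axis c 1"
    have v: "(\<Sum>j\<in>UNIV. v $ j) = 0" by (simp add: v_def sum_subtractf sum_axis)
    have sgn: "v $ j = 0 \<or> j = l \<or> j = c" for j by (auto simp: v_def axis_def)
    have lc: "v $ l = 1" "v $ c = - 1" using l(1) by (auto simp: v_def axis_def)
    have neg: "j = c" if "v $ j < 0" for j using sgn[of j] lc that by auto
    have pos: "j = l" if "0 < v $ j" for j using sgn[of j] lc that by auto
    obtain e where e: "0 < e" "x + e *\<^sub>R v \<in> ?D"
      by (rule small_perturbation_mem_cube_slice[OF x v]) (use neg pos l c in blast)+
    have v': "(\<Sum>j\<in>UNIV. (- v) $ j) = 0" using v by (simp add: sum_negf)
    have neg': "0 < x $ j" if "(- v) $ j < 0" for j using pos[of j] that l by simp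
    have pos': "x $ j < 1" if "0 < (- v) $ j" for j using neg[of j] that c by simp
    obtain e' where e': "0 < e'" "x + e' *\<^sub>R (- v) \<in> ?D"
      by (rule small_perturbation_mem_cube_slice[OF x v' neg' pos'])
    have "v \<noteq> 0" using lc by auto
    then have "x \<in> open_segment (x + e *\<^sub>R v) (x + e' *\<^sub>R (- v))"
      using e e' by (intro mem_open_segment_opposite)
    then show False using that e e' unfolding extreme_point_of_def by blast
  qed
  then have ext: "{x. x extreme_point_of ?D} \<subseteq> {x. (\<forall>j. x $ j \<in> {0, 1}) \<and> (\<Sum>j\<in>UNIV. x $ j) = real k}"
    by (auto simp: extreme_point_of_def)
  have "?D = convex hull {x. x extreme_point_of ?D}"
    by (rule Krein_Milman_Minkowski[OF compact_cube_slice convex_cube_slice])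
  also have "\<dots> \<subseteq> hypersimplex k"
    unfolding hypersimplex_def by (rule hull_mono[OF ext])
  finally show "?D \<subseteq> hypersimplex k" .
qed

section \<open>The quotient by the all-ones vector, faces and feasible directions\<close>

lemma ones_quotient_eq_0:
  fixes q :: "real ^ 'n \<Rightarrow> 'a::euclidean_space"
  assumes "ones_quotient q" "q v = 0" "(\<Sum>j\<in>UNIV. v $ j) = 0"
  shows "v = 0"
proof -
  have "v \<in> span {\<chi> j. 1}" using assms(1,2) unfolding ones_quotient_def by blast
  then obtain c where "v = c *\<^sub>R (\<chi> j. 1)" by (auto simp: span_singleton)
  then show ?thesis using assms(3) by (simp add: vec_eq_iff)
qed

text \<open>This identifies the hypersimplex with its image: the kernel of \<open>q\<close> meets
  the zero-sum hyperplane only in 0.\<close>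

lemma inj_on_ones_quotient:
  assumes "ones_quotient q"
  shows "inj_on q {v. (\<Sum>j\<in>UNIV. v $ j) = c}"
proof (rule inj_onI)
  fix x y assume "x \<in> {v. (\<Sum>j\<in>UNIV. v $ j) = c}" "y \<in> {v. (\<Sum>j\<in>UNIV. v $ j) = c}" "q x = q y"
  moreover have "linear q" using assms by (simp add: ones_quotient_def)
  ultimately have "x - y = 0"
    by (intro ones_quotient_eq_0[OF assms]) (simp_all add: linear_diff sum_subtractf)
  then show "x = y" by simp
qed

text \<open>For a point of the hypersimplex, these are the coordinates that may vary on the smallest
  face containing it.\<close>

abbreviation fractional :: "real ^ 'n \<Rightarrow> 'n set" where
  "fractional x \<equiv> {j. 0 < x $ j \<and> x $ j < 1}"

text \<open>Adjoining one basis vector with index in \<open>C\<close> to the zero-sum vectors spans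
  all vectors supported on \<open>C\<close>. For empty \<open>C\<close> the truncated difference is
  0, the dimension of the zero space.\<close>

lemma dim_zero_sum_supported:
  fixes C :: "'n::finite set"
  shows "dim {v :: real ^ 'n. (\<Sum>j\<in>UNIV. v $ j) = 0 \<and> (\<forall>j. j \<notin> C \<longrightarrow> v $ j = 0)} = card C - 1"
    (is "dim ?D = _")
proof (cases "C = {}")
  case True
  then have "?D = {0}" by (auto simp: vec_eq_iff)
  then show ?thesis using True by simp
next
  case False
  then obtain c where c: "c \<in> C" by blast
  have D: "subspace ?D"
    by (auto simp: subspace_def sum.distrib sum_distrib_left[symmetric])
  have "span ?D = ?D" using D by simp
  moreover have "axis c 1 \<notin> ?D" by (simp add: sum_axis)
  ultimately have "axis c 1 \<notin> span ?D" by (simp only: not_False_eq_True)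
  then have "dim (insert (axis c 1) ?D) = dim ?D + 1" by (simp add: dim_insert)
  moreover have "span (insert (axis c 1) ?D) = {v :: real ^ 'n. \<forall>j. j \<notin> C \<longrightarrow> v $ j = 0}"
  proof
    have "subspace {v :: real ^ 'n. \<forall>j. j \<notin> C \<longrightarrow> v $ j = 0}" by (simp add: subspace_def)
    then show "span (insert (axis c 1) ?D) \<subseteq> {v. \<forall>j. j \<notin> C \<longrightarrow> v $ j = 0}"
      by (rule span_minimal[rotated]) (use c in \<open>auto simp: axis_def\<close>)
    show "{v. \<forall>j. j \<notin> C \<longrightarrow> v $ j = 0} \<subseteq> span (insert (axis c 1) ?D)"
    proof clarify
      fix v :: "real ^ 'n" assume v: "\<forall>j. j \<notin> C \<longrightarrow> v $ j = 0"
      let ?s = "\<Sum>j\<in>UNIV. v $ j"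
      have "v - ?s *\<^sub>R axis c 1 \<in> ?D"
      proof -
        have "axis c (1::real) $ j = 0" if "j \<notin> C" for j using c that by (auto simp: axis_def)
        then show ?thesis using v by (simp add: sum_subtractf sum_distrib_left[symmetric] sum_axis)
      qed
      then show "v \<in> span (insert (axis c 1) ?D)"
        unfolding span_insert by (blast intro: span_base)
    qed
  qed
  then have "dim (span (insert (axis c 1) ?D)) = card C"
    by (simp only: dim_substandard_cart dim_vec_eq[symmetric])
  then have "dim (insert (axis c 1) ?D) = card C" by (simp only: dim_span)
  ultimately show ?thesis by simp
qed

text \<open>Every zero-sum direction supported on the fractional coordinates can be followed both
  ways from \<open>x\<close>, so a face through \<open>q x\<close> extends in all these
  directions.\<close>

lemma card_fractional_le_aff_dim:
  fixes q :: "real ^ 'n \<Rightarrow> 'a::euclidean_space"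
  assumes q: "ones_quotient q" and x: "x \<in> hypersimplex k"
    and F: "F face_of q ` hypersimplex k" "q x \<in> F"
  shows "int (card (fractional x)) - 1 \<le> aff_dim F"
proof -
  let ?D = "{v :: real ^ 'n. (\<Sum>j\<in>UNIV. v $ j) = 0 \<and> (\<forall>j. j \<notin> fractional x \<longrightarrow> v $ j = 0)}"
  let ?T = "(\<lambda>y. y - q x) ` F"
  have lin: "linear q" using q by (simp add: ones_quotient_def)
  have D: "subspace ?D"
    by (auto simp: subspace_def sum.distrib sum_distrib_left[symmetric])
  have x': "\<And>j. 0 \<le> x $ j \<and> x $ j \<le> 1" "(\<Sum>j\<in>UNIV. x $ j) = real k"
    using x by (auto simp: hypersimplex_eq)
  have "q v \<in> span ?T" if v: "v \<in> ?D" for v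
  proof (cases "v = 0")
    case True
    then show ?thesis using linear_0[OF lin] by (simp add: span_zero)
  next
    case False
    have supp: "0 < x $ j \<and> x $ j < 1" if "v $ j \<noteq> 0" for j using v that by auto
    have sum: "(\<Sum>j\<in>UNIV. v $ j) = 0" "(\<Sum>j\<in>UNIV. (- v) $ j) = 0"
      using v by (auto simp: sum_negf)
    obtain e where e: "0 < e" "x + e *\<^sub>R v \<in> hypersimplex k"
      by (rule small_perturbation_mem_cube_slice[OF x' sum(1)])
         (use supp in \<open>auto simp: hypersimplex_eq less_imp_neq\<close>)
    obtain e' where e': "0 < e'" "x + e' *\<^sub>R (- v) \<in> hypersimplex k"
      by (rule small_perturbation_mem_cube_slice[OF x' sum(2)])
         (use supp in \<open>auto simp: hypersimplex_eq less_imp_neq\<close>)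
    have qe: "q (x + r *\<^sub>R w) = q x + r *\<^sub>R q w" for r w
      by (simp add: linear_add[OF lin] linear_scale[OF lin])
    have "q v \<noteq> 0" using ones_quotient_eq_0[OF q _ sum(1)] False by blast
    then have "q x \<in> open_segment (q (x + e *\<^sub>R v)) (q (x + e' *\<^sub>R (- v)))"
      using e(1) e'(1) unfolding qe linear_neg[OF lin] by (intro mem_open_segment_opposite)
    then have "q (x + e *\<^sub>R v) \<in> F"
      using F e(2) e'(2) unfolding face_of_def by blast
    then have "e *\<^sub>R q v \<in> ?T" unfolding qe by (force simp: image_iff)
    then have "(1 / e) *\<^sub>R (e *\<^sub>R q v) \<in> span ?T" by (intro span_scale span_base)
    then show ?thesis using e(1) by simp
  qed
  then have "dim (q ` ?D) \<le> dim ?T"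
    by (intro dim_mono) auto
  moreover have "dim (q ` ?D) = dim ?D"
  proof (rule dim_image_eq[OF lin])
    have "span ?D = ?D" using D by simp
    then show "inj_on q (span ?D)"
      using inj_on_subset[OF inj_on_ones_quotient[OF q, of 0]] by (metis (no_types, lifting) Collect_mono)
  qed
  moreover have "aff_dim F = int (dim ?T)"
    by (rule aff_dim_eq_dim_subtract) (simp add: F hull_inc)
  ultimately show ?thesis using dim_zero_sum_supported[of "fractional x"] by linarith
qed

text \<open>The face freezes the coordinates of \<open>x\<close> that are 0 or 1. Since 0 and 1 are
  extreme in the unit interval, the endpoints of an open segment through a point of \<open>G\<close>
  are frozen as well.\<close>

lemma ex_face_aff_dim_le:
  fixes q :: "real ^ 'n \<Rightarrow> 'a::euclidean_space"
  assumes q: "ones_quotient q" and x: "x \<in> hypersimplex k"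
  obtains F where "F face_of q ` hypersimplex k" "q x \<in> F" "aff_dim F \<le> int (card (fractional x) - 1)"
proof -
  let ?D = "{v :: real ^ 'n. (\<Sum>j\<in>UNIV. v $ j) = 0 \<and> (\<forall>j. j \<notin> fractional x \<longrightarrow> v $ j = 0)}"
  define G where "G = {y \<in> hypersimplex k. \<forall>j. j \<notin> fractional x \<longrightarrow> y $ j = x $ j}"
  have lin: "linear q" using q by (simp add: ones_quotient_def)
  have conv: "convex (hypersimplex k :: (real ^ 'n) set)"
    by (simp add: hypersimplex_def)
  have xG: "x \<in> G" using x by (simp add: G_def)
  have G: "G face_of hypersimplex k"
    unfolding face_of_def
  proof (intro conjI ballI impI)
    show "convex G"
      unfolding convex_def
    proof (intro ballI allI impI)
      fix a b :: "real ^ 'n" and u v :: real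
      assume ab: "a \<in> G" "b \<in> G" "0 \<le> u" "0 \<le> v" "u + v = 1"
      then have "u *\<^sub>R a + v *\<^sub>R b \<in> hypersimplex k"
        using conv by (simp add: convex_def G_def)
      moreover have "(u *\<^sub>R a + v *\<^sub>R b) $ j = x $ j" if "j \<notin> fractional x" for j
      proof -
        have "a $ j = x $ j" "b $ j = x $ j" using ab that by (auto simp: G_def)
        then show ?thesis using ab(5) by (simp add: distrib_right[symmetric])
      qed
      ultimately show "u *\<^sub>R a + v *\<^sub>R b \<in> G" unfolding G_def by blast
    qed
    fix a b z assume ab: "a \<in> hypersimplex k" "b \<in> hypersimplex k" "z \<in> G" "z \<in> open_segment a b"
    then obtain t where t: "0 < t" "t < 1" "z = (1 - t) *\<^sub>R a + t *\<^sub>R b"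
      by (auto simp: in_segment)
    have "a $ j = x $ j \<and> b $ j = x $ j" if j: "j \<notin> fractional x" for j
    proof -
      have ab01: "0 \<le> a $ j" "a $ j \<le> 1" "0 \<le> b $ j" "b $ j \<le> 1"
        using ab by (auto simp: hypersimplex_eq)
      have "z $ j = x $ j" using ab(3) j by (auto simp: G_def)
      then have eq: "x $ j = (1 - t) * a $ j + t * b $ j" using t(3) by simp
      have "0 \<le> x $ j \<and> x $ j \<le> 1" using x by (simp add: hypersimplex_eq)
      then consider "x $ j = 0" | "x $ j = 1" using j by fastforce
      then show ?thesis
      proof cases
        case 1
        then have "(1 - t) * a $ j = 0 \<and> t * b $ j = 0"
          using eq ab01 t by (intro add_nonneg_eq_0_iff[THEN iffD1]) auto
        then show ?thesis using 1 t by auto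
      next
        case 2
        then have "(1 - t) * (1 - a $ j) + t * (1 - b $ j) = 0" using eq by (simp add: algebra_simps)
        then have "(1 - t) * (1 - a $ j) = 0 \<and> t * (1 - b $ j) = 0"
          using ab01 t by (intro add_nonneg_eq_0_iff[THEN iffD1]) auto
        then show ?thesis using 2 t by auto
      qed
    qed
    then show "a \<in> G" "b \<in> G" using ab(1,2) unfolding G_def by blast+
  qed (auto simp: G_def)
  \<comment> \<open>The criterion for strict preservation is applied to \<open>q\<close> itself,
    whose injectivity on the slice carries the face \<open>G\<close> over to the quotient.\<close>
  have "strictly_preserved q (hypersimplex k) G"
  proof (unfold strictly_preserved_iff[OF lin conv G], intro ballI impI)
    fix a b assume "a \<in> G" "b \<in> hypersimplex k" "q a = q b"
    then show "a = b"
      using inj_onD[OF inj_on_ones_quotient[OF q, of "real k"]] by (simp add: G_def hypersimplex_eq)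
  qed
  then have face: "q ` G face_of q ` hypersimplex k" by (simp add: strictly_preserved_def)
  have "(\<lambda>y. y - q x) ` q ` G \<subseteq> q ` ?D"
  proof clarify
    fix y assume "y \<in> G"
    then have "y - x \<in> ?D" using x by (auto simp: G_def hypersimplex_eq sum_subtractf)
    then show "q y - q x \<in> q ` ?D" by (metis (no_types, lifting) lin linear_diff image_eqI)
  qed
  then have "dim ((\<lambda>y. y - q x) ` q ` G) \<le> dim ?D"
    using dim_subset dim_image_le[OF lin] order_trans by meson
  moreover have "aff_dim (q ` G) = int (dim ((\<lambda>y. y - q x) ` q ` G))"
    by (rule aff_dim_eq_dim_subtract) (simp add: xG hull_inc)
  ultimately have "aff_dim (q ` G) \<le> int (card (fractional x) - 1)"
    using dim_zero_sum_supported[of "fractional x"] by linarith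
  then show thesis using that face xG by blast
qed

text \<open>By the two preceding lemmas, the points on faces of dimension at most \<open>i\<close>
  are the images of the points with at most \<open>i + 1\<close> fractional coordinates, so the
  fibre criteria of all these faces combine into one condition.\<close>

lemma preserving_iff_fibres:
  fixes q :: "real ^ 'n \<Rightarrow> 'a::euclidean_space" and \<pi> :: "'a \<Rightarrow> 'b::euclidean_space"
  assumes q: "ones_quotient q" and \<pi>: "linear \<pi>"
  shows "preserving i \<pi> (q ` hypersimplex k) \<longleftrightarrow>
    (\<forall>x\<in>hypersimplex k. \<forall>y\<in>hypersimplex k.
       card (fractional x) \<le> i + 1 \<longrightarrow> \<pi> (q x) = \<pi> (q y) \<longrightarrow> x = y)"
proof -
  have lin: "linear q" using q by (simp add: ones_quotient_def)
  have conv: "convex (q ` hypersimplex k)"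
    using convex_linear_image[OF lin] by (simp add: hypersimplex_def)
  have inj: "x = y" if "x \<in> hypersimplex k" "y \<in> hypersimplex k" "q x = q y" for x y
    using inj_onD[OF inj_on_ones_quotient[OF q, of "real k"]] that by (simp add: hypersimplex_eq)
  show ?thesis
  proof (intro iffI ballI impI)
    fix x y assume pres: "preserving i \<pi> (q ` hypersimplex k)"
      and xy: "x \<in> hypersimplex k" "y \<in> hypersimplex k" "card (fractional x) \<le> i + 1" "\<pi> (q x) = \<pi> (q y)"
    obtain F where F: "F face_of q ` hypersimplex k" "q x \<in> F" "aff_dim F \<le> int (card (fractional x) - 1)"
      using ex_face_aff_dim_le[OF q xy(1)] .
    then have "strictly_preserved \<pi> (q ` hypersimplex k) F"
      using pres xy(3) by (auto simp: preserving_def)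
    then have "q x = q y"
      using strictly_preserved_iff[OF \<pi> conv F(1)] F(2) xy by blast
    then show "x = y" using inj xy by blast
  next
    assume fib: "\<forall>x\<in>hypersimplex k. \<forall>y\<in>hypersimplex k.
       card (fractional x) \<le> i + 1 \<longrightarrow> \<pi> (q x) = \<pi> (q y) \<longrightarrow> x = y"
    show "preserving i \<pi> (q ` hypersimplex k)"
      unfolding preserving_def
    proof (intro allI impI, elim conjE)
      fix F assume F: "F face_of q ` hypersimplex k" "aff_dim F \<le> int i"
      show "strictly_preserved \<pi> (q ` hypersimplex k) F"
        unfolding strictly_preserved_iff[OF \<pi> conv F(1)]
      proof clarify
        fix a y assume a: "a \<in> F" and y: "y \<in> hypersimplex k" "\<pi> a = \<pi> (q y)"
        obtain x where x: "x \<in> hypersimplex k" "a = q x"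
          using F(1) a face_of_imp_subset by blast
        then have "card (fractional x) \<le> i + 1"
          using card_fractional_le_aff_dim[OF q x(1) F(1)] a F(2) by simp
        then show "a = q y" using fib x y by blast
      qed
    qed
  qed
qed

text \<open>Any zero-sum vector negative exactly on \<open>N\<close> and positive exactly on
  \<open>P\<close> is a feasible direction at such a point. The point is 1 on a set
  \<open>B\<close>, constant on a set \<open>C\<close>, and 0 elsewhere.\<close>

lemma hypersimplex_point_with_bounded_support:
  fixes N P :: "'n::finite set"
  assumes k: "1 \<le> k" "k < CARD('n)" and NP: "N \<inter> P = {}"
    and card: "card N \<le> k + i" "card P + k \<le> CARD('n) + i"
  obtains x :: "real ^ 'n" where "x \<in> hypersimplex k" "card (fractional x) \<le> i + 1"
    "\<And>j. j \<in> N \<Longrightarrow> 0 < x $ j" "\<And>j. j \<in> P \<Longrightarrow> x $ j < 1"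
proof -
  \<comment> \<open>The last condition says that the constant value on a nonempty \<open>C\<close>
    that makes the coordinate sum \<open>k\<close> lies strictly between 0 and 1.\<close>
  have "\<exists>B C. B \<inter> C = {} \<and> N \<subseteq> B \<union> C \<and> B \<inter> P = {} \<and> card C \<le> i + 1 \<and>
      (C = {} \<and> card B = k \<or> card B < k \<and> k < card B + card C)"
  proof -
    have cP: "card (- P) = CARD('n) - card P" by (simp add: Compl_eq_Diff_UNIV card_Diff_subset)
    have "card P \<le> CARD('n)" by (simp add: card_mono)
    consider "card N \<le> k" "card P + k \<le> CARD('n)" | "k < card N" | "CARD('n) < card P + k" by linarith
    then show ?thesis
    proof cases
      case 1
      have "N \<subseteq> - P" using NP by blast
      moreover have "k \<le> card (- P)" using 1 cP by linarith
      ultimately obtain B where "N \<subseteq> B" "B \<subseteq> - P" "card B = k"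
        using exists_subset_between[of N k "- P"] 1(1) by auto
      then have "B \<inter> {} = {} \<and> N \<subseteq> B \<union> {} \<and> B \<inter> P = {} \<and> card {} \<le> i + 1 \<and> card B = k"
        by auto
      then show ?thesis by blast
    next
      case 2
      \<comment> \<open>Taking only \<open>k - 1\<close> ones inside \<open>N\<close> leaves at
        least two and at most \<open>i + 1\<close> elements of \<open>N\<close> to be
        fractional.\<close>
      then have "k - 1 \<le> card N" by linarith
      then obtain B where B: "B \<subseteq> N" "card B = k - 1"
        by (rule obtain_subset_with_card_n)
      then have "card (N - B) = card N - (k - 1)" by (simp add: card_Diff_subset finite_subset)
      then have cards: "card (N - B) \<le> i + 1" "card B < k" "k < card B + card (N - B)"
        using 2 B(2) card(1) k(1) by linarith+
      show ?thesis
        by (rule exI[of _ B], rule exI[of _ "N - B"]) (use B(1) NP cards in blast)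
    next
      case 3
      \<comment> \<open>The mirror image of the previous case: \<open>CARD('n) - k - 1\<close> zeros
        inside \<open>P\<close>, ones off \<open>P\<close>, and the rest of \<open>P\<close>
        fractional.\<close>
      then have "CARD('n) - k - 1 \<le> card P" by linarith
      then obtain A where A: "A \<subseteq> P" "card A = CARD('n) - k - 1"
        by (rule obtain_subset_with_card_n)
      then have "card (P - A) = card P - (CARD('n) - k - 1)" by (simp add: card_Diff_subset finite_subset)
      then have cards: "card (P - A) \<le> i + 1" "card (- P) < k" "k < card (- P) + card (P - A)"
        using 3 A(2) card(2) k cP \<open>card P \<le> CARD('n)\<close> by linarith+
      show ?thesis
        by (rule exI[of _ "- P"], rule exI[of _ "P - A"]) (use NP cards in blast)
    qed
  qed
  then obtain B C where BC: "B \<inter> C = {}" "N \<subseteq> B \<union> C" "B \<inter> P = {}" "card C \<le> i + 1"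
      "C = {} \<and> card B = k \<or> card B < k \<and> k < card B + card C" by blast
  define r where "r = (real k - real (card B)) / real (card C)"
  have r: "0 < r \<and> r < 1" if "C \<noteq> {}"
    using BC(5) that by (auto simp: r_def field_simps card_gt_0_iff)
  define x :: "real ^ 'n" where "x = (\<chi> j. if j \<in> B then 1 else if j \<in> C then r else 0)"
  have rC: "0 < r" "r < 1" if "j \<in> C" for j using r that by auto
  have x01: "0 \<le> x $ j \<and> x $ j \<le> 1" for j using rC[of j] by (auto simp: x_def less_imp_le)
  have "(\<Sum>j\<in>UNIV. x $ j) = (\<Sum>j\<in>B \<union> C. x $ j)"
    by (rule sum.mono_neutral_right) (auto simp: x_def)
  also have "\<dots> = (\<Sum>j\<in>B. x $ j) + (\<Sum>j\<in>C. x $ j)"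
    using BC(1) by (intro sum.union_disjoint) auto
  also have "(\<Sum>j\<in>B. x $ j) = real (card B)" by (simp add: x_def)
  also have "(\<Sum>j\<in>C. x $ j) = (\<Sum>j\<in>C. r)"
    using BC(1) by (intro sum.cong) (auto simp: x_def)
  also have "real (card B) + (\<Sum>j\<in>C. r) = real k"
    using BC(5) by (auto simp: r_def)
  finally have "x \<in> hypersimplex k" using x01 by (simp add: hypersimplex_eq)
  moreover have "card (fractional x) \<le> i + 1"
  proof -
    have "fractional x \<subseteq> C" by (auto simp: x_def split: if_splits)
    then have "card (fractional x) \<le> card C" by (intro card_mono) auto
    then show ?thesis using BC(4) by simp
  qed
  moreover have "0 < x $ j" if "j \<in> N" for j
  proof -
    have "j \<in> B \<or> j \<in> C" using that BC(2) by blast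
    then show ?thesis using rC[of j] by (auto simp: x_def)
  qed
  moreover have "x $ j < 1" if "j \<in> P" for j
  proof -
    have "j \<notin> B" using that BC(3) by blast
    then show ?thesis using rC[of j] by (auto simp: x_def less_imp_le)
  qed
  ultimately show thesis by (rule that)
qed

text \<open>Going from \<open>x\<close> to \<open>y\<close>, a coordinate can drop only where
  \<open>x\<close> is positive and rise only where \<open>x\<close> is below 1. Fractional
  coordinates, if present, have a sum strictly between 0 and their number, which bounds the number
  of ones from both sides.\<close>

lemma sign_bounds_of_difference:
  fixes x y :: "real ^ 'n"
  assumes x: "x \<in> hypersimplex k" and y: "y \<in> hypersimplex k" and card: "card (fractional x) \<le> i + 1"
  shows "card {j. (y - x) $ j < 0} \<le> k + i \<and> card {j. 0 < (y - x) $ j} + k \<le> CARD('n) + i"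
proof -
  let ?B = "{j. x $ j = 1}" and ?C = "fractional x"
  have x01: "0 \<le> x $ j \<and> x $ j \<le> 1" and y01: "0 \<le> y $ j \<and> y $ j \<le> 1" for j
    using x y by (auto simp: hypersimplex_eq)
  have sum: "real k = real (card ?B) + (\<Sum>j\<in>?C. x $ j)"
    using sum_eq_card_ones_plus_fractional[of x] x x01 by (simp add: hypersimplex_eq)
  have bounds: "card ?B + card ?C \<le> k + i \<and> k \<le> card ?B + i"
  proof (cases "?C = {}")
    case True
    then show ?thesis using sum by (simp only: sum.empty) simp
  next
    case False
    have "(\<Sum>j\<in>?C. 0) < (\<Sum>j\<in>?C. x $ j)" by (rule sum_strict_mono) (use False in auto)
    moreover have "(\<Sum>j\<in>?C. x $ j) < (\<Sum>j\<in>?C. 1)" by (rule sum_strict_mono) (use False in auto)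
    ultimately have "real (card ?B) < real k" "real k < real (card ?B + card ?C)" using sum by auto
    then show ?thesis using card by (simp only: of_nat_less_iff) linarith
  qed
  have "card {j. (y - x) $ j < 0} \<le> card (?B \<union> ?C)"
  proof (rule card_mono)
    show "{j. (y - x) $ j < 0} \<subseteq> ?B \<union> ?C"
    proof
      fix j assume "j \<in> {j. (y - x) $ j < 0}"
      then show "j \<in> ?B \<union> ?C" using x01[of j] y01[of j] by auto
    qed
  qed simp
  also have "\<dots> \<le> card ?B + card ?C" by (rule card_Un_le)
  finally have "card {j. (y - x) $ j < 0} \<le> k + i" using bounds by linarith
  moreover have "card {j. 0 < (y - x) $ j} \<le> card (- ?B)"
  proof (rule card_mono)
    show "{j. 0 < (y - x) $ j} \<subseteq> - ?B"
    proof
      fix j assume "j \<in> {j. 0 < (y - x) $ j}"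
      then show "j \<in> - ?B" using y01[of j] by auto
    qed
  qed simp
  moreover have "card (- ?B) + card ?B = CARD('n)"
    using card_Un_disjoint[of "- ?B" ?B] by (simp add: Compl_partition2)
  ultimately show ?thesis using bounds by linarith
qed

subsection \<open>Sign conditions on the dependences of a projected simplex\<close>

text \<open>The set is a union, over the label sets with more than \<open>m\<close> elements, of
  finite intersections of open sets. A general family \<open>g\<close> covers positive and negative
  entries alike.\<close>

lemma open_card_components:
  fixes g :: "'n::finite \<Rightarrow> real ^ 'n \<Rightarrow> real"
  assumes "\<And>j. continuous_on UNIV (g j)"
  shows "open {v. m < card {j. 0 < g j v}}"
proof -
  have "{v. m < card {j. 0 < g j v}} = (\<Union>T\<in>{T. m < card T}. \<Inter>j\<in>T. {v. 0 < g j v})"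
  proof (intro equalityI subsetI)
    fix v assume "v \<in> {v. m < card {j. 0 < g j v}}"
    then show "v \<in> (\<Union>T\<in>{T. m < card T}. \<Inter>j\<in>T. {v. 0 < g j v})"
      by (intro UN_I[of "{j. 0 < g j v}"]) auto
  next
    fix v assume "v \<in> (\<Union>T\<in>{T. m < card T}. \<Inter>j\<in>T. {v. 0 < g j v})"
    then obtain T where T: "m < card T" "T \<subseteq> {j. 0 < g j v}" by auto
    then have "card T \<le> card {j. 0 < g j v}" by (intro card_mono) auto
    then show "v \<in> {v. m < card {j. 0 < g j v}}" using T(1) by simp
  qed
  then show ?thesis
    using assms by (auto intro!: open_UN open_INT open_Collect_less continuous_on_const)
qed

text \<open>A coordinate subspace of dimension \<open>CARD('n) + 1 - dim U\<close> is just too large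
  to meet \<open>U\<close> only in 0.\<close>

lemma subspace_sparse_vector:
  fixes U :: "(real ^ 'n) set"
  assumes "subspace U" "1 \<le> dim U"
  obtains v where "v \<in> U" "v \<noteq> 0" "card {j. v $ j \<noteq> 0} + dim U \<le> CARD('n) + 1"
proof -
  have "CARD('n) + 1 - dim U \<le> CARD('n)" using assms(2) by linarith
  then obtain T :: "'n set" where T: "card T = CARD('n) + 1 - dim U"
    by (rule obtain_subset_with_card_n)
  let ?Z = "{v :: real ^ 'n. \<forall>j. j \<notin> T \<longrightarrow> v $ j = 0}"
  have Z: "subspace ?Z" by (simp add: subspace_def)
  have dZ: "dim ?Z = card T" by (simp only: dim_substandard_cart dim_vec_eq[symmetric])
  have le: "dim X \<le> CARD('n)" for X :: "(real ^ 'n) set" using dim_subset_UNIV_cart[of X] .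
  have "dim {x + y |x y. x \<in> U \<and> y \<in> ?Z} + dim (U \<inter> ?Z) = dim U + dim ?Z"
    by (rule dim_sums_Int[OF assms(1) Z])
  then have "dim (U \<inter> ?Z) \<noteq> 0" using T dZ le[of U] le[of "{x + y |x y. x \<in> U \<and> y \<in> ?Z}"] by linarith
  then obtain v where v: "v \<in> U" "v \<in> ?Z" "v \<noteq> 0" by (auto simp: dim_eq_0)
  have "{j. v $ j \<noteq> 0} \<subseteq> T" using v(2) by auto
  then have "card {j. v $ j \<noteq> 0} \<le> card T" by (intro card_mono) auto
  then show thesis using that[OF v(1,3)] T le[of U] by linarith
qed

section \<open>The dependence space of a projected configuration\<close>

lemma proj_config_combination:
  assumes "linear q" "linear \<pi>"
  shows "(\<Sum>j\<in>UNIV. v $ j *\<^sub>R proj_config q \<pi> j) = \<pi> (q v)"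
proof -
  have "(\<Sum>j\<in>UNIV. v $ j *\<^sub>R proj_config q \<pi> j) = \<pi> (q (\<Sum>j\<in>UNIV. v $ j *\<^sub>R axis j 1))"
    using assms by (simp add: proj_config_def linear_sum linear_scale)
  also have "(\<Sum>j\<in>UNIV. v $ j *\<^sub>R axis j 1) = v"
    using basis_expansion[of v] by (simp add: scalar_mult_eq_scaleR)
  finally show ?thesis .
qed

lemma affine_dependences_proj_config:
  assumes "linear q" "linear \<pi>"
  shows "affine_dependences (proj_config q \<pi>) = {v. (\<Sum>j\<in>UNIV. v $ j) = 0 \<and> \<pi> (q v) = 0}"
  by (simp add: affine_dependences_def proj_config_combination[OF assms])

text \<open>The kernel of the composition of \<open>\<pi>\<close> with \<open>q\<close> is spanned
  by the dependences and the all-ones vector, whose nonzero sum keeps it outside them; rank-nullity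
  does the count.\<close>

lemma dim_affine_dependences:
  fixes q :: "real ^ 'n \<Rightarrow> 'a::euclidean_space" and \<pi> :: "'a \<Rightarrow> 'b::euclidean_space"
  assumes q: "ones_quotient q" and \<pi>: "linear \<pi>"
  shows "dim (affine_dependences (proj_config q \<pi>)) + dim (range \<pi>) + 1 = CARD('n)"
proof -
  let ?A = "affine_dependences (proj_config q \<pi>)" and ?one = "(\<chi> j. 1) :: real ^ 'n"
  have lin: "linear q" and surj: "surj q" and ker: "{x. q x = 0} = span {?one}"
    using q by (auto simp: ones_quotient_def)
  have f: "linear (\<lambda>x. \<pi> (q x))" using linear_compose[OF lin \<pi>] by (simp add: o_def)
  have A: "?A = {v. (\<Sum>j\<in>UNIV. v $ j) = 0 \<and> \<pi> (q v) = 0}"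
    by (rule affine_dependences_proj_config[OF lin \<pi>])
  have "?one \<in> {x. q x = 0}" unfolding ker by (simp add: span_base)
  then have one: "\<pi> (q ?one) = 0" using linear_0[OF \<pi>] by simp
  have spanA: "span ?A = ?A" using subspace_affine_dependences by simp
  moreover have "?one \<notin> ?A" by (simp add: A)
  ultimately have "?one \<notin> span ?A" by (simp only: not_False_eq_True)
  then have ins: "dim (insert ?one ?A) = dim ?A + 1" by (simp add: dim_insert)
  have "span (insert ?one ?A) = {x. \<pi> (q x) = 0}"
  proof
    have "subspace {x. \<pi> (q x) = 0}"
      by (simp add: subspace_def linear_0[OF lin] linear_0[OF \<pi>] linear_add[OF lin] linear_add[OF \<pi>]
          linear_scale[OF lin] linear_scale[OF \<pi>])
    then show "span (insert ?one ?A) \<subseteq> {x. \<pi> (q x) = 0}"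
      by (rule span_minimal[rotated]) (use one A in auto)
    show "{x. \<pi> (q x) = 0} \<subseteq> span (insert ?one ?A)"
    proof clarify
      fix x assume x: "\<pi> (q x) = 0"
      let ?c = "(\<Sum>j\<in>UNIV. x $ j) / CARD('n)"
      have "x - ?c *\<^sub>R ?one \<in> ?A"
        using x one f by (simp add: A sum_subtractf linear_diff[OF f] linear_scale[OF f])
      then show "x \<in> span (insert ?one ?A)"
        unfolding span_insert by (blast intro: span_base)
    qed
  qed
  then have "dim {x. \<pi> (q x) = 0} = dim ?A + 1" using ins by (metis dim_span)
  moreover have "range (\<lambda>x. \<pi> (q x)) = range \<pi>"
    using surj by (metis image_image)
  ultimately show ?thesis
    using dim_range_plus_dim_kernel[OF f] by simp
qed

text \<open>Because \<open>q\<close> kills the all-ones vector, the barycentre of the configuration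
  is the origin, so its affine hull is its linear span, namely the range of
  \<open>\<pi>\<close>.\<close>

lemma aff_dim_proj_config:
  fixes q :: "real ^ 'n \<Rightarrow> 'a::euclidean_space" and \<pi> :: "'a \<Rightarrow> 'b::euclidean_space"
  assumes q: "ones_quotient q" and \<pi>: "linear \<pi>"
  shows "aff_dim (range (proj_config q \<pi>)) = int (dim (range \<pi>))"
proof -
  let ?S = "proj_config q \<pi>" and ?one = "(\<chi> j. 1) :: real ^ 'n"
  have lin: "linear q" and surj: "surj q" and ker: "{x. q x = 0} = span {?one}"
    using q by (auto simp: ones_quotient_def)
  have "?one \<in> {x. q x = 0}" unfolding ker by (simp add: span_base)
  then have "q ?one = 0" by simp
  then have "(\<Sum>j\<in>UNIV. ?S j) = 0"
    using proj_config_combination[OF lin \<pi>, of ?one] linear_0[OF \<pi>] by simp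
  then have "(\<Sum>j\<in>UNIV. (1 / CARD('n)) *\<^sub>R ?S j) = 0"
    by (simp add: scaleR_sum_right[symmetric])
  moreover have "(\<Sum>j\<in>UNIV. (1 / CARD('n)) *\<^sub>R ?S j) \<in> convex hull (range ?S)"
    by (rule convex_sum) (auto simp: hull_inc)
  ultimately have "0 \<in> affine hull (range ?S)"
    using convex_hull_subset_affine_hull by fastforce
  then have "aff_dim (range ?S) = int (dim (range ?S))" by (rule aff_dim_zero)
  moreover have "span (range ?S) = range \<pi>"
  proof
    show "span (range ?S) \<subseteq> range \<pi>"
      by (rule span_minimal) (auto simp: proj_config_def linear_subspace_image[OF \<pi>])
    show "range \<pi> \<subseteq> span (range ?S)"
    proof clarify
      fix a
      obtain v where "a = q v" using surj by (metis surjD)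
      then have "\<pi> a = (\<Sum>j\<in>UNIV. v $ j *\<^sub>R ?S j)" by (simp add: proj_config_combination[OF lin \<pi>])
      then show "\<pi> a \<in> span (range ?S)" by (simp add: span_sum span_scale span_base)
    qed
  qed
  ultimately show ?thesis by (metis dim_span)
qed

text \<open>A dependence violating both inequalities is feasible at some point with at most
  \<open>i + 1\<close> fractional coordinates, so two points share an image; conversely, two such
  points differ by a dependence violating both. Adding \<open>k\<close> on the right avoids
  truncated subtraction.\<close>

lemma preserving_iff_signs:
  fixes q :: "real ^ 'n \<Rightarrow> 'a::euclidean_space" and \<pi> :: "'a \<Rightarrow> 'b::euclidean_space"
  assumes q: "ones_quotient q" and \<pi>: "linear \<pi>" and k: "1 \<le> k" "k < CARD('n)"
  shows "preserving i \<pi> (q ` hypersimplex k) \<longleftrightarrow>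
    (\<forall>v\<in>affine_dependences (proj_config q \<pi>). v \<noteq> 0 \<longrightarrow>
       k + i < card {j. v $ j < 0} \<or> CARD('n) + i < card {j. 0 < v $ j} + k)"
proof -
  have lin: "linear q" using q by (simp add: ones_quotient_def)
  have f: "linear (\<lambda>x. \<pi> (q x))" using linear_compose[OF lin \<pi>] by (simp add: o_def)
  note A = affine_dependences_proj_config[OF lin \<pi>]
  show ?thesis
    unfolding preserving_iff_fibres[OF q \<pi>]
  proof (intro iffI ballI impI)
    fix v assume fib: "\<forall>x\<in>hypersimplex k. \<forall>y\<in>hypersimplex k.
       card (fractional x) \<le> i + 1 \<longrightarrow> \<pi> (q x) = \<pi> (q y) \<longrightarrow> x = y"
      and v: "v \<in> affine_dependences (proj_config q \<pi>)" "v \<noteq> 0"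
    show "k + i < card {j. v $ j < 0} \<or> CARD('n) + i < card {j. 0 < v $ j} + k"
    proof (rule ccontr)
      assume "\<not> ?thesis"
      then have card: "card {j. v $ j < 0} \<le> k + i" "card {j. 0 < v $ j} + k \<le> CARD('n) + i" by auto
      have "{j. v $ j < 0} \<inter> {j. 0 < v $ j} = {}" by auto
      then obtain x where x: "x \<in> hypersimplex k" "card (fractional x) \<le> i + 1"
        "\<And>j. j \<in> {j. v $ j < 0} \<Longrightarrow> 0 < x $ j" "\<And>j. j \<in> {j. 0 < v $ j} \<Longrightarrow> x $ j < 1"
        using hypersimplex_point_with_bounded_support[OF k _ card] by blast
      have x': "\<And>j. 0 \<le> x $ j \<and> x $ j \<le> 1" "(\<Sum>j\<in>UNIV. x $ j) = real k"
        using x(1) by (auto simp: hypersimplex_eq)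
      have v0: "(\<Sum>j\<in>UNIV. v $ j) = 0" "\<pi> (q v) = 0" using v(1) by (auto simp: A)
      obtain e where e: "0 < e" "x + e *\<^sub>R v \<in> hypersimplex k"
        by (rule small_perturbation_mem_cube_slice[OF x' v0(1)]) (use x(3,4) in \<open>auto simp: hypersimplex_eq\<close>)
      have "\<pi> (q x) = \<pi> (q (x + e *\<^sub>R v))"
        using v0(2) by (simp add: linear_add[OF f] linear_scale[OF f])
      then have "x = x + e *\<^sub>R v" using fib x e by blast
      then show False using e(1) v(2) by simp
    qed
  next
    fix x y assume signs: "\<forall>v\<in>affine_dependences (proj_config q \<pi>). v \<noteq> 0 \<longrightarrow>
       k + i < card {j. v $ j < 0} \<or> CARD('n) + i < card {j. 0 < v $ j} + k"
      and xy: "x \<in> hypersimplex k" "y \<in> hypersimplex k" "card (fractional x) \<le> i + 1" "\<pi> (q x) = \<pi> (q y)"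
    have "y - x \<in> affine_dependences (proj_config q \<pi>)"
      using xy by (simp add: A hypersimplex_eq sum_subtractf linear_diff[OF f])
    then have "y - x = 0"
      using signs sign_bounds_of_difference[OF xy(1-3)] by (meson not_less)
    then show "x = y" by simp
  qed
qed

text \<open>The two sign conditions are open and exclude each other, and negation maps the second one
  into the first. If the nonzero dependences form a connected set, the second one therefore
  never occurs.\<close>
lemma dim_affine_dependences_le_1:
  fixes S :: "'n::finite \<Rightarrow> 'b::euclidean_space"
  assumes signs: "\<And>v. v \<in> affine_dependences S \<Longrightarrow> v \<noteq> 0 \<Longrightarrow>
       k + i < card {j. v $ j < 0} \<or> CARD('n) + i < card {j. 0 < v $ j} + k"
    and k: "2 * k \<le> CARD('n)"
    and v: "v \<in> affine_dependences S" "v \<noteq> 0" "CARD('n) + i < card {j. 0 < v $ j} + k"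
  shows "dim (affine_dependences S) \<le> 1"
proof (rule ccontr)
  let ?A = "affine_dependences S"
  let ?N = "{v :: real ^ 'n. k + i < card {j. v $ j < 0}}"
    and ?P = "{v :: real ^ 'n. CARD('n) + i - k < card {j. 0 < v $ j}}"
  have P_iff: "v \<in> ?P \<longleftrightarrow> CARD('n) + i < card {j. 0 < v $ j} + k" for v
    using k by auto
  assume "\<not> dim ?A \<le> 1"
  \<comment> \<open>Dimension 1 is the exceptional case in which removing a point disconnects a
    convex set.\<close>
  then have "aff_dim ?A \<noteq> 1" by (simp add: aff_dim_subspace[OF subspace_affine_dependences])
  then have conn: "connected (?A - {0})"
    by (intro connected_punctured_convex subspace_imp_convex subspace_affine_dependences)
  have "open ?N"
    using open_card_components[of "\<lambda>j v. - v $ j" "k + i"] by (simp add: continuous_intros)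
  moreover have "open ?P"
    by (rule open_card_components) (simp add: continuous_intros)
  moreover have "?A - {0} \<subseteq> ?P \<union> ?N"
  proof
    fix w assume "w \<in> ?A - {0}"
    then have "w \<in> ?N \<or> w \<in> ?P" using signs[of w] unfolding P_iff by simp
    then show "w \<in> ?P \<union> ?N" by blast
  qed
  moreover have "?P \<inter> ?N = {}"
  proof -
    have "card {j. 0 < w $ j} + card {j. w $ j < 0} \<le> CARD('n)" for w :: "real ^ 'n"
    proof -
      have "card {j. 0 < w $ j} + card {j. w $ j < 0} = card ({j. 0 < w $ j} \<union> {j. w $ j < 0})"
        by (rule card_Un_disjoint[symmetric]) auto
      then show ?thesis by (simp add: card_mono)
    qed
    note bound = this
    show ?thesis
    proof (rule equals0I)
      fix w assume "w \<in> ?P \<inter> ?N"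
      then have "CARD('n) + i < card {j. 0 < w $ j} + k" "k + i < card {j. w $ j < 0}"
        using P_iff by blast+
      then show False using bound[of w] by linarith
    qed
  qed
  moreover have "v \<in> ?P \<inter> (?A - {0})" using v P_iff by blast
  \<comment> \<open>More than \<open>CARD('n) - k + i\<close> negative entries are more than
    \<open>k + i\<close>, by \<open>2 * k \<le> CARD('n)\<close>.\<close>
  moreover have "- v \<in> ?N \<inter> (?A - {0})"
  proof -
    have "k + i < card {j. (- v) $ j < 0}" using v(3) k by simp
    then show ?thesis using v(2) affine_dependences_uminus[OF v(1)] by simp
  qed
  ultimately show False
    using connectedD[OF conn, of ?P ?N] by blast
qed


section \<open>The equivalence and the dimension bounds\<close>

lemma neighborly_imp_preserving:
  fixes q :: "real ^ 'n \<Rightarrow> 'a::euclidean_space" and \<pi> :: "'a \<Rightarrow> 'b::euclidean_space"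
  assumes q: "ones_quotient q" and \<pi>: "linear \<pi>" and k: "1 \<le> k" "k < CARD('n)"
    and nb: "neighborly (int k + int i) (proj_config q \<pi>)"
  shows "preserving i \<pi> (q ` hypersimplex k)"
proof -
  have "neighborly (int (k + i)) (proj_config q \<pi>)" using nb by simp
  then show ?thesis
    using neighborly_iff[of "k + i" "proj_config q \<pi>"] k preserving_iff_signs[OF q \<pi> k] by simp
qed

text \<open>The dependences form a line spanned by some \<open>u\<close> with more than
  \<open>CARD('n) - k + i\<close> positive entries. Positive multiples of \<open>u\<close> satisfy
  the second sign condition, negative multiples the first.\<close>

lemma not_almost_neighborly_imp_preserving:
  fixes q :: "real ^ 'n \<Rightarrow> 'a::euclidean_space" and \<pi> :: "'a \<Rightarrow> 'b::euclidean_space"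
  assumes q: "ones_quotient q" and \<pi>: "linear \<pi>" and k: "1 \<le> k" "2 * k \<le> CARD('n)"
    and dim: "aff_dim (range (proj_config q \<pi>)) = int CARD('n) - 2"
    and nan: "\<not> almost_neighborly (int k - int i - 1) (proj_config q \<pi>)"
  shows "preserving i \<pi> (q ` hypersimplex k)"
proof -
  let ?A = "affine_dependences (proj_config q \<pi>)"
  have kn: "k < CARD('n)" using k by linarith
  have dA: "dim ?A = 1"
    using dim dim_affine_dependences[OF q \<pi>] aff_dim_proj_config[OF q \<pi>] by linarith
  have "int k - int i - 1 < int CARD('n)" using kn by linarith
  with nan obtain u where u: "u \<in> ?A" "u \<noteq> 0" "int (card {l. u $ l \<le> 0}) \<le> int k - int i - 1"
    by (rule dependence_if_not_almost_neighborly)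
  have "{l. 0 < u $ l} = - {l. u $ l \<le> 0}" by auto
  then have "card {l. 0 < u $ l} = CARD('n) - card {l. u $ l \<le> 0}"
    by (simp add: Compl_eq_Diff_UNIV card_Diff_subset)
  moreover have "card {l. u $ l \<le> 0} \<le> CARD('n)" by (simp add: card_mono)
  ultimately have pos: "CARD('n) + i < card {l. 0 < u $ l} + k" using u(3) by linarith
  show ?thesis
    unfolding preserving_iff_signs[OF q \<pi> k(1) kn]
  proof (intro ballI impI)
    fix v assume v: "v \<in> ?A" "v \<noteq> 0"
    have "v \<in> span {u}"
    proof (rule ccontr)
      assume "v \<notin> span {u}"
      then have "dim {v, u} = 2" using u(2) by (simp add: dim_insert)
      moreover have "dim {v, u} \<le> dim ?A" by (rule dim_subset) (use u v in auto)
      ultimately show False using dA by simp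
    qed
    then obtain c where c: "v = c *\<^sub>R u" by (auto simp: span_singleton)
    with v(2) consider "0 < c" | "c < 0" by fastforce
    then show "k + i < card {j. v $ j < 0} \<or> CARD('n) + i < card {j. 0 < v $ j} + k"
    proof cases
      case 1
      then have "{j. 0 < v $ j} = {j. 0 < u $ j}" by (simp add: c zero_less_mult_iff)
      then show ?thesis using pos by simp
    next
      case 2
      then have "{j. v $ j < 0} = {j. 0 < u $ j}" by (auto simp: c mult_less_0_iff)
      then show ?thesis using pos k(2) by simp
    qed
  qed
qed

text \<open>Without neighborliness some dependence \<open>v\<close> fails the first sign condition
  and hence satisfies the second. This bounds the dimension by 1, and \<open>v\<close> has at most
  \<open>k - i - 1\<close> nonpositive entries.\<close>

lemma preserving_imp:
  fixes q :: "real ^ 'n \<Rightarrow> 'a::euclidean_space" and \<pi> :: "'a \<Rightarrow> 'b::euclidean_space"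
  assumes q: "ones_quotient q" and \<pi>: "linear \<pi>" and k: "1 \<le> k" "2 * k \<le> CARD('n)"
    and pres: "preserving i \<pi> (q ` hypersimplex k)"
    and nnb: "\<not> neighborly (int k + int i) (proj_config q \<pi>)"
  shows "aff_dim (range (proj_config q \<pi>)) = int CARD('n) - 2"
    and "\<not> almost_neighborly (int k - int i - 1) (proj_config q \<pi>)"
proof -
  let ?A = "affine_dependences (proj_config q \<pi>)"
  have kn: "k < CARD('n)" using k by linarith
  have signs: "k + i < card {j. v $ j < 0} \<or> CARD('n) + i < card {j. 0 < v $ j} + k"
    if "v \<in> ?A" "v \<noteq> 0" for v
    using pres that preserving_iff_signs[OF q \<pi> k(1) kn] by blast
  have "\<not> neighborly (int (k + i)) (proj_config q \<pi>)" using nnb by simp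
  then obtain v where v: "v \<in> ?A" "v \<noteq> 0" "\<not> k + i < card {j. v $ j < 0}"
    using neighborly_iff[of "k + i" "proj_config q \<pi>"] k(1) by auto
  then have pos: "CARD('n) + i < card {j. 0 < v $ j} + k" using signs by blast
  have "dim ?A \<noteq> 0" using v by (auto simp: dim_eq_0)
  moreover have "dim ?A \<le> 1" by (rule dim_affine_dependences_le_1[OF signs k(2) v(1,2) pos])
  ultimately show "aff_dim (range (proj_config q \<pi>)) = int CARD('n) - 2"
    using dim_affine_dependences[OF q \<pi>] aff_dim_proj_config[OF q \<pi>] by linarith
  have "{l. v $ l \<le> 0} = - {l. 0 < v $ l}" by auto
  then have "card {l. v $ l \<le> 0} = CARD('n) - card {l. 0 < v $ l}"
    by (simp add: Compl_eq_Diff_UNIV card_Diff_subset)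
  moreover have "card {l. 0 < v $ l} \<le> CARD('n)" by (simp add: card_mono)
  ultimately have "int (card {l. v $ l \<le> 0}) \<le> int k - int i - 1" using pos by linarith
  then show "\<not> almost_neighborly (int k - int i - 1) (proj_config q \<pi>)"
    by (rule not_almost_neighborly_if_dependence[OF v(1,2)])
qed

text \<open>Neighborliness forces more than \<open>m\<close> entries of either sign in every affine dependence,
  while there is always a dependence among any \<open>d + 2\<close> of the points.\<close>
lemma neighborly_dim_bound:
  fixes q :: "real ^ 'n \<Rightarrow> 'a::euclidean_space" and \<pi> :: "'a \<Rightarrow> 'b::euclidean_space"
  assumes q: "ones_quotient q" and \<pi>: "linear \<pi>" and m: "1 \<le> m"
    and nb: "neighborly (int m) (proj_config q \<pi>)"
  shows "2 * m \<le> dim (range \<pi>) \<or> dim (range \<pi>) = CARD('n) - 1"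
proof (cases "dim (affine_dependences (proj_config q \<pi>)) = 0")
  case True
  then show ?thesis using dim_affine_dependences[OF q \<pi>] by linarith
next
  case False
  let ?A = "affine_dependences (proj_config q \<pi>)"
  have "1 \<le> dim ?A" using False by linarith
  \<comment> \<open>With \<open>d\<close> the dimension of the range, \<open>v\<close> has at most
    \<open>d + 2\<close> nonzero entries, while neighborliness applied to \<open>v\<close> and
    \<open>- v\<close> forces at least \<open>2 * m + 2\<close>.\<close>
  then obtain v where v: "v \<in> ?A" "v \<noteq> 0" "card {j. v $ j \<noteq> 0} + dim ?A \<le> CARD('n) + 1"
    by (rule subspace_sparse_vector[OF subspace_affine_dependences])
  have neg: "m < card {j. w $ j < 0}" if "w \<in> ?A" "w \<noteq> 0" for w
    using nb that neighborly_iff[OF m] by blast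
  have "m < card {j. v $ j < 0}" using neg[OF v(1,2)] .
  moreover have "m < card {j. 0 < v $ j}"
    using neg[OF affine_dependences_uminus[OF v(1)]] v(2) by simp
  moreover have "card {j. v $ j < 0} + card {j. 0 < v $ j} = card ({j. v $ j < 0} \<union> {j. 0 < v $ j})"
    by (rule card_Un_disjoint[symmetric]) auto
  moreover have "{j. v $ j < 0} \<union> {j. 0 < v $ j} = {j. v $ j \<noteq> 0}" by auto
  ultimately have "2 * m + 2 \<le> card {j. v $ j \<noteq> 0}" by simp
  then show ?thesis using v(3) dim_affine_dependences[OF q \<pi>] by linarith
qed

theorem theorem3p6:
  fixes q :: "real ^ 'n \<Rightarrow> 'a::euclidean_space"
    and W :: "'b::euclidean_space set"
    and n k i d :: nat
  assumes "n = CARD('n)"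
    and "1 \<le> k" and "2 * k \<le> n"
    and "i \<le> n - 1"
    and "d \<le> n - 1"
    and "ones_quotient q"
    and "subspace W" and "dim W = d"
  shows "(\<forall>\<pi>. linear_projection_onto W \<pi> \<longrightarrow>
            (preserving i \<pi> (q ` hypersimplex k) \<longleftrightarrow>
               neighborly (int k + int i) (proj_config q \<pi>)
             \<or> (aff_dim (range (proj_config q \<pi>)) = int n - 2
                 \<and> \<not> almost_neighborly (int k - int i - 1) (proj_config q \<pi>))
             \<or> bij_betw \<pi> UNIV W))
       \<and> ((\<exists>\<pi>. linear_projection_onto W \<pi> \<and> preserving i \<pi> (q ` hypersimplex k)) \<longrightarrow>
               (2 * k + 2 * i \<le> d \<and> d \<le> n - 1 \<or> d = n - 1 \<and> n - 1 \<ge> k + i)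
             \<or> (d = n - 2 \<and> k \<ge> i + 2)
             \<or> d = n - 1)"
proof -
  note n = assms(1) and k = assms(2,3)[unfolded assms(1)] and q = assms(6)
  have kn: "k < CARD('n)" using k by linarith
  have iff: "preserving i \<pi> (q ` hypersimplex k) \<longleftrightarrow>
               neighborly (int k + int i) (proj_config q \<pi>)
             \<or> (aff_dim (range (proj_config q \<pi>)) = int n - 2
                 \<and> \<not> almost_neighborly (int k - int i - 1) (proj_config q \<pi>))
             \<or> bij_betw \<pi> UNIV W"
    and dims: "preserving i \<pi> (q ` hypersimplex k) \<Longrightarrow> (2 * k + 2 * i \<le> d \<and> d \<le> n - 1 \<or> d = n - 1 \<and> n - 1 \<ge> k + i)
             \<or> (d = n - 2 \<and> k \<ge> i + 2) \<or> d = n - 1"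
    if proj: "linear_projection_onto W \<pi>" for \<pi>
  proof -
    let ?pres = "preserving i \<pi> (q ` hypersimplex k)" and ?bij = "bij_betw \<pi> UNIV W"
    let ?nb = "neighborly (int k + int i) (proj_config q \<pi>)"
    let ?nan = "aff_dim (range (proj_config q \<pi>)) = int n - 2
                 \<and> \<not> almost_neighborly (int k - int i - 1) (proj_config q \<pi>)"
    have \<pi>: "linear \<pi>" and range: "range \<pi> = W"
      using proj by (auto simp: linear_projection_onto_def)
    have lin: "linear q" using q by (simp add: ones_quotient_def)
    \<comment> \<open>An injective \<open>\<pi>\<close> leaves only the zero dependence, so the sign
      condition holds vacuously.\<close>
    have ?pres if ?bij
    proof -
      have "v = 0" if v: "v \<in> affine_dependences (proj_config q \<pi>)" for v
      proof -
        have s: "(\<Sum>j\<in>UNIV. v $ j) = 0" "\<pi> (q v) = \<pi> 0"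
          using v linear_0[OF \<pi>] by (auto simp: affine_dependences_proj_config[OF lin \<pi>])
        have "inj \<pi>" using \<open>?bij\<close> by (simp add: bij_betw_def)
        then have "q v = 0" using s(2) by (rule injD)
        then show ?thesis using s(1) by (rule ones_quotient_eq_0[OF q])
      qed
      then show ?thesis using preserving_iff_signs[OF q \<pi> k(1) kn] by blast
    qed
    moreover have ?pres if ?nb using neighborly_imp_preserving[OF q \<pi> k(1) kn that] .
    moreover have ?pres if ?nan using not_almost_neighborly_imp_preserving[OF q \<pi> k] that n by simp
    moreover have ?nan if ?pres "\<not> ?nb" using preserving_imp[OF q \<pi> k that] n by simp
    ultimately show "?pres \<longleftrightarrow> ?nb \<or> ?nan \<or> ?bij" by blast
    assume ?pres
    show "(2 * k + 2 * i \<le> d \<and> d \<le> n - 1 \<or> d = n - 1 \<and> n - 1 \<ge> k + i)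
             \<or> (d = n - 2 \<and> k \<ge> i + 2) \<or> d = n - 1"
    proof (cases ?nb)
      case True
      then have "2 * (k + i) \<le> dim (range \<pi>) \<or> dim (range \<pi>) = CARD('n) - 1"
        using neighborly_dim_bound[OF q \<pi>, of "k + i"] k(1) by simp
      then show ?thesis using range assms(5,8) n by auto
    next
      case False
      then have nan: ?nan using preserving_imp[OF q \<pi> k \<open>?pres\<close>] n by simp
      have "int d = int n - 2"
        using nan aff_dim_proj_config[OF q \<pi>] range assms(8) by simp
      then have "d = n - 2" by linarith
      moreover have "k \<ge> i + 2"
      proof -
        \<comment> \<open>A witness against almost neighborliness is nonempty, so the bound
          \<open>k - i - 1\<close> is at least 1.\<close>
        have "int k - int i - 1 < int CARD('n)" using kn by linarith
        with conjunct2[OF nan] have "1 \<le> int k - int i - 1"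
          by (rule dependence_if_not_almost_neighborly)
        then show ?thesis by linarith
      qed
      ultimately show ?thesis by blast
    qed
  qed
  show ?thesis using iff dims by blast
qed

end
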